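(* Let $\mathcal{X}\in\mathcal{M}_{\leq\mathbf{r}}$ have Tucker rank $\underline{\mathbf{r}}=(\underline r_1,\dots,\underline r_d)$ and Tucker decomposition $\mathcal{X}=\mathcal{G}\times_{k=1}^d\mathbf{U}_k$, and let $I=\{k\in[d]:\underline r_k<r_k\}$. For $k\in[d]$ put $S_k=\mathrm{span}(\mathbf{U}_k)$ if $k\in[d]\setminus I$ and $S_k=\mathbb{R}^{n_k}$ if $k\in I$; let $\mathrm{P}_{\mathbf{U}_k}^\perp=\mathbf{I}_{n_k}-\mathbf{U}_k\mathbf{U}_k^\top$ and $\mathbf{V}_k=\mathbf{U}_d\otimes\cdots\otimes\mathbf{U}_{k+1}\otimes\mathbf{U}_{k-1}\otimes\cdots\otimes\mathbf{U}_1$. Then the normal cone of $\mathcal{M}_{\leq\mathbf{r}}$ at $\mathcal{X}$ is $$\mathrm{N}_{\mathcal{X}}\mathcal{M}_{\leq\mathbf{r}}=(S_1\otimes S_2\otimes\cdots\otimes S_d)^\perp\cap\{\mathcal{W}\in\mathbb{R}^{n_1\times\cdots\times n_d}:\mathrm{P}_{\mathbf{U}_k}^\perp\mathbf{W}_{(k)}\mathbf{V}_k\mathbf{G}_{(k)}^\top=0\ \text{for all }k\in[d]\setminus I\}.$$ More precisely, the elements $\mathcal{W}$ of $\mathrm{N}_{\mathcal{X}}\mathcal{M}_{\leq\mathbf{r}}$ are explicitly parametrized by $$\mathcal{W}=\sum_{i_1,i_2,\dots,i_d=0}^1\Big(\sum_{k\in[d]\setminus I}i_k^2\Big)\,\mathcal{C}_{i_1,\dots,i_d}\times_{k=1}^d\mathbf{U}_k^{(i_k)},$$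 where $\mathbf{U}_k^{(0)}:=\mathbf{U}_k$, $\mathbf{U}_k^{(1)}:=\mathbf{U}_k^\perp\in\mathrm{St}(n_k-\underline r_k,n_k)$ satisfies $\mathrm{span}(\mathbf{U}_k^\perp)=\mathrm{span}(\mathbf{U}_k)^\perp$, and $\mathcal{C}_{i_1,\dots,i_d}\in\mathbb{R}^{\tilde n_1\times\cdots\times\tilde n_d}$ with $\tilde n_k=(1-i_k)\underline r_k+i_k(n_k-\underline r_k)$ is arbitrary subject to: $(\mathcal{C}_{i_1,\dots,i_d})_{(k)}\mathbf{G}_{(k)}^\top=0$ whenever $i_k=1$ and $i_j=0$ for all $j\in[d]\setminus\{k\}$.
   Context: Let $d,n_1,\dots,n_d$ be positive integers, $[d]=\{1,\dots,d\}$, $\mathbf{r}=(r_1,\dots,r_d)$ an array of positive integers, and $n_{-k}=\prod_{i\ne k}n_i$. Real tensors carry the entrywise inner product $\langle\cdot,\cdot\rangle$. The mode-$k$ unfolding of $\mathcal{X}\in\mathbb{R}^{n_1\times\cdots\times n_d}$ is the matrix $\mathbf{X}_{(k)}\in\mathbb{R}^{n_k\times n_{-k}}$ whose $(i_k,j)$ entry is $\mathcal{X}(i_1,\dots,i_d)$, with $j=1+\sum_{\ell\neq k}(i_\ell-1)\prod_{m<\ell,\,m\ne k}n_m$. The $k$-mode product $\mathcal{X}\times_k\mathbf{A}$ is the tensor with $(\mathcal{X}\times_k\mathbf{A})_{(k)}=\mathbf{A}\mathbf{X}_{(k)}$, and $\times_{k=1}^d$ denotes successive products. For matrices $\otimes$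 is the Kronecker product; for subspaces $S_k\subseteq\mathbb{R}^{n_k}$, $S_1\otimes\cdots\otimes S_d\subseteq\mathbb{R}^{n_1\times\cdots\times n_d}$ is the tensor product subspace. $\mathrm{St}(r,n)=\{\mathbf{X}\in\mathbb{R}^{n\times r}:\mathbf{X}^\top\mathbf{X}=\mathbf{I}_r\}$, and $\mathrm{span}$ of a matrix is its column space. The Tucker rank is $\mathrm{rank}_{\mathrm{tc}}(\mathcal{X})=(\mathrm{rank}(\mathbf{X}_{(1)}),\dots,\mathrm{rank}(\mathbf{X}_{(d)}))$, and $\mathcal{M}_{\leq\mathbf{r}}=\{\mathcal{X}\in\mathbb{R}^{n_1\times\cdots\times n_d}:\mathrm{rank}_{\mathrm{tc}}(\mathcal{X})\leq\mathbf{r}\}$ (componentwise). If $\mathrm{rank}_{\mathrm{tc}}(\mathcal{X})=\underline{\mathbf{r}}$, a Tucker decomposition is $\mathcal{X}=\mathcal{G}\times_{k=1}^d\mathbf{U}_k$ with core $\mathcal{G}\in\mathbb{R}^{\underline r_1\times\cdots\times\underline r_d}$ and $\mathbf{U}_k\in\mathrm{St}(\underline r_k,n_k)$; $\mathbf{G}_{(k)}$ is the mode-$k$ unfolding of $\mathcal{G}$ (factors with zero columns are interpreted as empty matrices). The (Bouligand) tangent cone of $C$ at $\mathcal{X}\in C$ is $\mathrm{T}_{\mathcal{X}}C=\{\mathcal{V}:\exists\, t^{(i)}\to0\ (t^{(i)}>0),\ \mathcal{X}^{(i)}\to\mathcal{X}\text{ in }C\text{ with }(\mathcal{X}^{(i)}-\mathcal{X})/t^{(i)}\to\mathcal{V}\}$,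 and the normal cone is its polar $\mathrm{N}_{\mathcal{X}}C=\{\mathcal{W}:\langle\mathcal{W},\mathcal{V}\rangle\leq0\ \text{for all }\mathcal{V}\in\mathrm{T}_{\mathcal{X}}C\}$. *)

theory Defs
  imports
    "Jordan_Normal_Form.DL_Rank"
    "HOL-Analysis.Function_Topology"
    "HOL-Library.Function_Algebras"
begin

text \<open>Modes and entries are numbered from 0, as in the matrix library. A multi-index of a tensor
  of order \<open>d\<close> with dimensions \<open>n 0, \<dots>, n (d - 1)\<close> is an extensional function on \<open>{..<d}\<close>. A tensor
  is a real function on multi-indices that vanishes off its index set, so that the tensors of given
  dimensions form a finite-dimensional subspace of the function space, on which the library's
  product topology is the Euclidean one.\<close>

type_synonym tensor = "(nat \<Rightarrow> nat) \<Rightarrow> real"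

definition multi_indices :: "nat \<Rightarrow> (nat \<Rightarrow> nat) \<Rightarrow> (nat \<Rightarrow> nat) set" where
  "multi_indices d n = (\<Pi>\<^sub>E k\<in>{..<d}. {..<n k})"

definition tensors :: "nat \<Rightarrow> (nat \<Rightarrow> nat) \<Rightarrow> tensor set" where
  "tensors d n = {X. \<forall>i. i \<notin> multi_indices d n \<longrightarrow> X i = 0}"

definition tensor_scale :: "real \<Rightarrow> tensor \<Rightarrow> tensor" where
  "tensor_scale c X = (\<lambda>i. c * X i)"

interpretation tensor: vector_space tensor_scale
  by unfold_locales (auto simp: tensor_scale_def plus_fun_def algebra_simps)

definition tensor_inner :: "nat \<Rightarrow> (nat \<Rightarrow> nat) \<Rightarrow> tensor \<Rightarrow> tensor \<Rightarrow> real" where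
  "tensor_inner d n X Y = (\<Sum>i\<in>multi_indices d n. X i * Y i)"

definition tensor_orth :: "nat \<Rightarrow> (nat \<Rightarrow> nat) \<Rightarrow> tensor set \<Rightarrow> tensor set" where
  "tensor_orth d n S = {W \<in> tensors d n. \<forall>V\<in>S. tensor_inner d n W V = 0}"

subsection \<open>Unfoldings and mode products\<close>

definition unfold_col :: "nat \<Rightarrow> (nat \<Rightarrow> nat) \<Rightarrow> nat \<Rightarrow> (nat \<Rightarrow> nat) \<Rightarrow> nat" where
  "unfold_col d n k i = (\<Sum>l\<in>{..<d} - {k}. i l * (\<Prod>m\<in>{..<l} - {k}. n m))"

definition unfolding_mat :: "nat \<Rightarrow> (nat \<Rightarrow> nat) \<Rightarrow> nat \<Rightarrow> tensor \<Rightarrow> real mat" where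
  "unfolding_mat d n k X = mat (n k) (\<Prod>l\<in>{..<d} - {k}. n l)
     (\<lambda>(a, j). X (THE i. i \<in> multi_indices d n \<and> i k = a \<and> unfold_col d n k i = j))"

text \<open>The description in \<^const>\<open>unfolding_mat\<close> is always proper: every matrix position belongs to
  exactly one multi-index.\<close>

lemma unfold_col_Suc:
  "unfold_col (Suc d) n k i =
     (if d = k then 0 else i d * (\<Prod>m\<in>{..<d} - {k}. n m)) + unfold_col d n k i"
  by (simp add: unfold_col_def lessThan_Suc insert_Diff_if)

lemma prod_except_Suc:
  fixes n :: "nat \<Rightarrow> nat"
  shows "(\<Prod>l\<in>{..<Suc d} - {k}. n l) = (if d = k then 1 else n d) * (\<Prod>l\<in>{..<d} - {k}. n l)"
  by (simp add: lessThan_Suc insert_Diff_if)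

lemma unfold_col_less:
  assumes "\<forall>l<d. i l < n l"
  shows "unfold_col d n k i < (\<Prod>l\<in>{..<d} - {k}. n l)"
  using assms
proof (induction d)
  case 0
  show ?case by (simp add: unfold_col_def)
next
  case (Suc d)
  let ?P = "\<Prod>l\<in>{..<d} - {k}. n l"
  have IH: "unfold_col d n k i < ?P" using Suc by simp
  show ?case
  proof (cases "d = k")
    case True
    then show ?thesis using IH unfolding unfold_col_Suc prod_except_Suc by simp
  next
    case False
    have "Suc (i d) * ?P \<le> n d * ?P" using Suc.prems by (intro mult_le_mono1) auto
    then have "i d * ?P + ?P \<le> n d * ?P" by simp
    with IH show ?thesis unfolding unfold_col_Suc prod_except_Suc using False by simp
  qed
qed

lemma unfold_col_inj:
  assumes "\<forall>l<d. i l < n l" "\<forall>l<d. i' l < n l" "unfold_col d n k i = unfold_col d n k i'"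
    "l < d" "l \<noteq> k"
  shows "i l = i' l"
  using assms
proof (induction d)
  case (Suc d)
  let ?P = "\<Prod>l\<in>{..<d} - {k}. n l"
  have lt: "unfold_col d n k i < ?P" "unfold_col d n k i' < ?P"
    using Suc.prems by (auto intro!: unfold_col_less)
  have eq: "unfold_col d n k i = unfold_col d n k i' \<and> (d = k \<or> i d = i' d)"
  proof (cases "d = k")
    case True
    then show ?thesis using Suc.prems(3) unfolding unfold_col_Suc by simp
  next
    case False
    have e: "i d * ?P + unfold_col d n k i = i' d * ?P + unfold_col d n k i'"
      using False Suc.prems(3) unfolding unfold_col_Suc by simp
    have "(i d * ?P + unfold_col d n k i) div ?P = (i' d * ?P + unfold_col d n k i') div ?P"
      by (simp only: e)
    moreover have "(a * p + b) div p = a" if "b < p" for a b p :: nat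
      using that by simp
    ultimately have "i d = i' d" using lt by metis
    then show ?thesis using e by simp
  qed
  show ?case
  proof (cases "l = d")
    case True
    then show ?thesis using eq Suc.prems by simp
  next
    case False
    show ?thesis
      by (rule Suc.IH) (use False eq Suc.prems in simp_all)
  qed
qed simp

lemma unfolding_mat_entry:
  assumes "i \<in> multi_indices d n" "k < d"
  shows "unfold_col d n k i < (\<Prod>l\<in>{..<d} - {k}. n l)"
    and "unfolding_mat d n k X $$ (i k, unfold_col d n k i) = X i"
proof -
  have i: "\<forall>l<d. i l < n l" using assms(1) by (auto simp: multi_indices_def)
  show lt: "unfold_col d n k i < (\<Prod>l\<in>{..<d} - {k}. n l)"
    by (rule unfold_col_less[OF i])
  have "(THE i'. i' \<in> multi_indices d n \<and> i' k = i k \<and> unfold_col d n k i' = unfold_col d n k i) = i"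
  proof (rule the_equality)
    fix i' assume i': "i' \<in> multi_indices d n \<and> i' k = i k \<and> unfold_col d n k i' = unfold_col d n k i"
    then have b: "\<forall>l<d. i' l < n l" by (auto simp: multi_indices_def)
    have "i' l = i l" if "l < d" for l
      using unfold_col_inj[OF b i, of k l] i' that by (cases "l = k") simp_all
    then show "i' = i"
      using i' assms(1) unfolding multi_indices_def
      by (intro PiE_ext[of i' "{..<d}" _ i]) auto
  qed (use assms in auto)
  then show "unfolding_mat d n k X $$ (i k, unfold_col d n k i) = X i"
    using lt i assms(2) by (simp add: unfolding_mat_def)
qed

text \<open>The tensor whose mode-\<open>k\<close> unfolding is \<open>A\<close> times the mode-\<open>k\<close> unfolding of \<open>X\<close>, where \<open>n\<close> are
  the dimensions of \<open>X\<close>; the result has dimension \<open>dim_row A\<close> in mode \<open>k\<close>.\<close>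

definition mode_prod :: "nat \<Rightarrow> (nat \<Rightarrow> nat) \<Rightarrow> nat \<Rightarrow> tensor \<Rightarrow> real mat \<Rightarrow> tensor" where
  "mode_prod d n k X A = (\<lambda>i. if i \<in> multi_indices d (n(k := dim_row A))
     then (A * unfolding_mat d n k X) $$ (i k, unfold_col d n k i) else 0)"

primrec mode_prods_upto ::
    "nat \<Rightarrow> (nat \<Rightarrow> nat) \<Rightarrow> tensor \<Rightarrow> (nat \<Rightarrow> real mat) \<Rightarrow> nat \<Rightarrow> tensor" where
  "mode_prods_upto d n X A 0 = X"
| "mode_prods_upto d n X A (Suc k) =
     mode_prod d (\<lambda>l. if l < k then dim_row (A l) else n l) k (mode_prods_upto d n X A k) (A k)"

definition mode_prods :: "nat \<Rightarrow> (nat \<Rightarrow> nat) \<Rightarrow> tensor \<Rightarrow> (nat \<Rightarrow> real mat) \<Rightarrow> tensor" where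
  "mode_prods d n X A = mode_prods_upto d n X A d"

subsection \<open>Matrices and subspaces\<close>

definition kron :: "real mat \<Rightarrow> real mat \<Rightarrow> real mat" where
  "kron A B = mat (dim_row A * dim_row B) (dim_col A * dim_col B)
     (\<lambda>(i, j). A $$ (i div dim_row B, j div dim_col B) * B $$ (i mod dim_row B, j mod dim_col B))"

text \<open>\<open>U (d - 1) \<otimes> \<dots> \<otimes> U (k + 1) \<otimes> U (k - 1) \<otimes> \<dots> \<otimes> U 0\<close>; the empty Kronecker product is the
  1-by-1 identity.\<close>

definition kron_except :: "nat \<Rightarrow> (nat \<Rightarrow> real mat) \<Rightarrow> nat \<Rightarrow> real mat" where
  "kron_except d U k = foldr kron (map U (rev (filter (\<lambda>l. l \<noteq> k) [0..<d]))) (1\<^sub>m 1)"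

definition stiefel :: "nat \<Rightarrow> nat \<Rightarrow> real mat set" where
  "stiefel r n = {U \<in> carrier_mat n r. U\<^sup>T * U = 1\<^sub>m r}"

definition proj_perp :: "real mat \<Rightarrow> real mat" where
  "proj_perp U = 1\<^sub>m (dim_row U) - U * U\<^sup>T"

definition mat_span :: "real mat \<Rightarrow> real vec set" where
  "mat_span A = vec_space.col_space (dim_row A) A"

definition vec_orth :: "nat \<Rightarrow> real vec set \<Rightarrow> real vec set" where
  "vec_orth n S = {v \<in> carrier_vec n. \<forall>u\<in>S. v \<bullet> u = 0}"

definition elementary_tensor :: "nat \<Rightarrow> (nat \<Rightarrow> nat) \<Rightarrow> (nat \<Rightarrow> real vec) \<Rightarrow> tensor" where
  "elementary_tensor d n v = (\<lambda>i. if i \<in> multi_indices d n then \<Prod>k<d. v k $ i k else 0)"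

definition tensor_prod_subspace ::
    "nat \<Rightarrow> (nat \<Rightarrow> nat) \<Rightarrow> (nat \<Rightarrow> real vec set) \<Rightarrow> tensor set" where
  "tensor_prod_subspace d n S =
     tensor.span {elementary_tensor d n v | v. \<forall>k<d. v k \<in> S k}"

subsection \<open>Tucker rank and decompositions\<close>

definition tucker_rank :: "nat \<Rightarrow> (nat \<Rightarrow> nat) \<Rightarrow> tensor \<Rightarrow> nat \<Rightarrow> nat" where
  "tucker_rank d n X k = vec_space.rank (n k) (unfolding_mat d n k X)"

definition tucker_variety :: "nat \<Rightarrow> (nat \<Rightarrow> nat) \<Rightarrow> (nat \<Rightarrow> nat) \<Rightarrow> tensor set" where
  "tucker_variety d n r = {X \<in> tensors d n. \<forall>k<d. tucker_rank d n X k \<le> r k}"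

definition tucker_decomposition ::
    "nat \<Rightarrow> (nat \<Rightarrow> nat) \<Rightarrow> tensor \<Rightarrow> (nat \<Rightarrow> nat) \<Rightarrow> tensor \<Rightarrow> (nat \<Rightarrow> real mat) \<Rightarrow> bool" where
  "tucker_decomposition d n X s G U \<longleftrightarrow>
     (\<forall>k<d. tucker_rank d n X k = s k) \<and> G \<in> tensors d s \<and>
     (\<forall>k<d. U k \<in> stiefel (s k) (n k)) \<and> X = mode_prods d s G U"

subsection \<open>Tangent and normal cones\<close>

definition tangent_cone :: "tensor set \<Rightarrow> tensor \<Rightarrow> tensor set" where
  "tangent_cone C X = {V. \<exists>t Y. (\<forall>j::nat. t j > 0) \<and> t \<longlonglongrightarrow> 0 \<and> (\<forall>j. Y j \<in> C) \<and> Y \<longlonglongrightarrow> X \<and>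
     (\<lambda>j. tensor_scale (1 / t j) (Y j - X)) \<longlonglongrightarrow> V}"

definition normal_cone :: "nat \<Rightarrow> (nat \<Rightarrow> nat) \<Rightarrow> tensor set \<Rightarrow> tensor \<Rightarrow> tensor set" where
  "normal_cone d n C X =
     {W \<in> tensors d n. \<forall>V\<in>tangent_cone C X. tensor_inner d n W V \<le> 0}"

end

theory Submission
  imports Defs
begin

text \<open>Let \<open>s\<close> be the Tucker rank of \<open>X = G \<times> U\<close>, and call a mode \<open>k\<close> saturated if
  \<open>s k = r k\<close>. A tensor \<open>W\<close> is normal to the variety at \<open>X\<close> exactly if it is orthogonal to two
  families of tensors:

  \<^item> elementary tensors whose \<open>k\<close>-th factor lies in the span of \<open>U k\<close> for saturated \<open>k\<close> and is
    arbitrary for the other \<open>k\<close>;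

  \<^item> tensors \<open>G \<times> U(k := F)\<close>, where \<open>k\<close> is saturated and the columns of \<open>F\<close> are orthogonal to
    those of \<open>U k\<close>.

  These conditions are necessary because, for \<open>V\<close> in either family, the whole line \<open>X + \<tau> V\<close> stays
  in the variety, so that \<open>V\<close> and \<open>-V\<close> are tangent. Adding a multiple of an elementary tensor
  raises a mode rank by at most one, which an unsaturated mode tolerates, and in a saturated mode
  it does not leave the column space of \<open>U k\<close>. In the second family,
  \<open>X + \<tau> V = G \<times> U(k := U k + \<tau> F)\<close> still has a core of dimensions \<open>s\<close>.

  They are sufficient because of what a tangent vector \<open>V\<close> looks like in a saturated mode \<open>k\<close>. The
  points that approach \<open>X\<close> have mode-\<open>k\<close> rank at most \<open>s k\<close>, so all their minors of order
  \<open>s k + 1\<close> vanish. The limit of suitably scaled bordered minors shows that \<open>P V\<^sub>k\<close>, for \<open>P\<close> the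
  projection orthogonal to \<open>U k\<close> and \<open>V\<^sub>k\<close> the unfolding, factors through the row space of the
  unfolding of \<open>X\<close> (lemma \<open>tangent_of_low_rank_matrices\<close>). Hence applying \<open>P\<close> to \<open>V\<close> in mode \<open>k\<close>
  yields a member of the second family. Subtracting these components one saturated mode at a time
  leaves the projection of \<open>V\<close> to the span of the first family, so \<open>W\<close> is orthogonal to \<open>V\<close>
  (lemma \<open>conditions_imp_inner_zero\<close>).

  Orthogonality to the first family is orthogonality to the tensor product subspace. Orthogonality
  to the second one becomes the matrix equation of the proposition, because \<open>A B\<^sup>T = 0\<close> says that
  \<open>A\<close> is orthogonal to \<open>F B\<close> for all \<open>F\<close>, and transformations move across the inner product to
  their transposes (lemma \<open>core_equation_iff\<close>). For the parametrization, the identity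
  \<open>1 = U k (U k)\<^sup>T + U' k (U' k)\<^sup>T\<close> in every mode cuts \<open>W\<close> into \<open>2 ^ d\<close> pieces. The first family
  forces the pieces to vanish that choose \<open>U'\<close> in no saturated mode, which is why the others may
  be weighted by the number of saturated modes in which they choose \<open>U'\<close>. The second family only
  constrains the pieces that choose \<open>U'\<close> in exactly one mode, a saturated one.\<close>

section \<open>Multilinear transformations of tensors\<close>

lemma finite_multi_indices [simp]: "finite (multi_indices d n)"
  unfolding multi_indices_def by (intro finite_PiE) auto

lemma multi_indices_less: "i \<in> multi_indices d n \<Longrightarrow> k < d \<Longrightarrow> i k < n k"
  by (auto simp: multi_indices_def)

lemma multi_indices_cong: "(\<And>k. k < d \<Longrightarrow> n k = m k) \<Longrightarrow> multi_indices d n = multi_indices d m"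
  unfolding multi_indices_def by (intro PiE_cong) auto

lemma fun_upd_multi_indices:
  assumes "i \<in> multi_indices d n" "k < d" "b < m k" "\<And>l. l < d \<Longrightarrow> l \<noteq> k \<Longrightarrow> m l = n l"
  shows "i(k := b) \<in> multi_indices d m"
  using assms by (auto simp: multi_indices_def PiE_iff extensional_def)

lemma sum_multi_indices_prod:
  fixes f :: "nat \<Rightarrow> nat \<Rightarrow> real"
  shows "(\<Sum>j\<in>multi_indices d m. \<Prod>k<d. f k (j k)) = (\<Prod>k<d. \<Sum>b<m k. f k b)"
  unfolding multi_indices_def by (rule prod_sum_PiE[symmetric]) auto

text \<open>The tensor \<open>X\<close> of dimensions \<open>m\<close> transformed by \<open>A k\<close> in every mode \<open>k\<close> at once.
  Successive mode products are given by this closed form, in which composition and adjoint reduce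
  to exchanging a sum with a product, and no intermediate dimensions occur.\<close>

definition mode_map ::
    "nat \<Rightarrow> (nat \<Rightarrow> nat) \<Rightarrow> (nat \<Rightarrow> nat) \<Rightarrow> (nat \<Rightarrow> real mat) \<Rightarrow> tensor \<Rightarrow> tensor" where
  "mode_map d n m A X = (\<lambda>i. if i \<in> multi_indices d n
     then \<Sum>j\<in>multi_indices d m. (\<Prod>k<d. A k $$ (i k, j k)) * X j else 0)"

lemma mode_map_cong:
  assumes "\<And>k. k < d \<Longrightarrow> n k = n' k" "\<And>k. k < d \<Longrightarrow> m k = m' k" "\<And>k. k < d \<Longrightarrow> A k = B k"
  shows "mode_map d n m A X = mode_map d n' m' B X"
  using assms multi_indices_cong[of d n n'] multi_indices_cong[of d m m']
  by (auto simp: mode_map_def fun_eq_iff intro!: sum.cong prod.cong)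

lemma mode_map_tensors [simp]: "mode_map d n m A X \<in> tensors d n"
  by (simp add: mode_map_def tensors_def)

lemma mode_map_compose:
  assumes B: "\<And>k. k < d \<Longrightarrow> B k \<in> carrier_mat (p k) (n k)"
    and A: "\<And>k. k < d \<Longrightarrow> A k \<in> carrier_mat (n k) (m k)"
  shows "mode_map d p n B (mode_map d n m A X) = mode_map d p m (\<lambda>k. B k * A k) X"
proof
  fix i
  show "mode_map d p n B (mode_map d n m A X) i = mode_map d p m (\<lambda>k. B k * A k) X i"
  proof (cases "i \<in> multi_indices d p")
    case i: True
    have "mode_map d p n B (mode_map d n m A X) i =
        (\<Sum>j\<in>multi_indices d n. \<Sum>h\<in>multi_indices d m.
           (\<Prod>k<d. B k $$ (i k, j k) * A k $$ (j k, h k)) * X h)"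
      using i by (simp add: mode_map_def sum_distrib_left prod.distrib mult.assoc)
    also have "\<dots> = (\<Sum>h\<in>multi_indices d m. (\<Sum>j\<in>multi_indices d n.
           \<Prod>k<d. B k $$ (i k, j k) * A k $$ (j k, h k)) * X h)"
      by (subst sum.swap) (simp add: sum_distrib_right)
    also have "\<dots> = (\<Sum>h\<in>multi_indices d m. (\<Prod>k<d. (B k * A k) $$ (i k, h k)) * X h)"
    proof (intro sum.cong arg_cong2[where f = "(*)"] refl)
      fix h assume h: "h \<in> multi_indices d m"
      have "(\<Sum>j\<in>multi_indices d n. \<Prod>k<d. B k $$ (i k, j k) * A k $$ (j k, h k)) =
          (\<Prod>k<d. \<Sum>b<n k. B k $$ (i k, b) * A k $$ (b, h k))"
        by (rule sum_multi_indices_prod)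
      also have "\<dots> = (\<Prod>k<d. (B k * A k) $$ (i k, h k))"
      proof (intro prod.cong refl)
        fix k assume "k \<in> {..<d}"
        then show "(\<Sum>b<n k. B k $$ (i k, b) * A k $$ (b, h k)) = (B k * A k) $$ (i k, h k)"
          using A[of k] B[of k] multi_indices_less[OF i, of k] multi_indices_less[OF h, of k]
          by (simp add: scalar_prod_def atLeast0LessThan)
      qed
      finally show "(\<Sum>j\<in>multi_indices d n. \<Prod>k<d. B k $$ (i k, j k) * A k $$ (j k, h k)) =
          (\<Prod>k<d. (B k * A k) $$ (i k, h k))" .
    qed
    finally show ?thesis using i by (simp add: mode_map_def)
  qed (simp add: mode_map_def)
qed

text \<open>The form in which composition is applied below: the composite matrices are usually
  known in a simplified form.\<close>

lemma mode_map_nested_factor: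
  assumes B: "\<And>l. l < d \<Longrightarrow> B l \<in> carrier_mat (p l) (n l)"
    and A: "\<And>l. l < d \<Longrightarrow> A l \<in> carrier_mat (n l) (m l)"
    and C: "\<And>l. l < d \<Longrightarrow> B l * A l = C l"
  shows "mode_map d p n B (mode_map d n m A X) = mode_map d p m C X"
  using mode_map_compose[of d B p n A m X, OF B A] mode_map_cong[of d p p m m "\<lambda>l. B l *
    A l" C X, OF refl refl C]
  by simp

lemma prod_one_mat:
  assumes "i \<in> multi_indices d n" "j \<in> multi_indices d n"
  shows "(\<Prod>k<d. 1\<^sub>m (n k) $$ (i k, j k)) = (if j = i then 1 else (0::real))"
proof (cases "j = i")
  case True
  then show ?thesis using assms by (simp add: multi_indices_less)
next
  case False
  then obtain k where "k < d" "i k \<noteq> j k"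
    using assms unfolding multi_indices_def by (metis PiE_ext lessThan_iff)
  then show ?thesis using assms False
    by (auto simp: multi_indices_less intro!: prod_zero bexI[of _ k])
qed

lemma mode_map_one:
  assumes "X \<in> tensors d n"
  shows "mode_map d n n (\<lambda>k. 1\<^sub>m (n k)) X = X"
proof
  fix i
  show "mode_map d n n (\<lambda>k. 1\<^sub>m (n k)) X i = X i"
  proof (cases "i \<in> multi_indices d n")
    case i: True
    have "(\<Sum>j\<in>multi_indices d n. (\<Prod>k<d. 1\<^sub>m (n k) $$ (i k, j k)) * X j) =
        (\<Sum>j\<in>multi_indices d n. if j = i then X j else 0)"
      by (intro sum.cong refl) (simp add: prod_one_mat[OF i])
    then show ?thesis using i by (simp add: mode_map_def)
  qed (use assms in \<open>simp add: mode_map_def tensors_def\<close>)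
qed

lemma unfold_col_cong:
  assumes "\<And>l. l < d \<Longrightarrow> l \<noteq> k \<Longrightarrow> i l = j l" "\<And>l. l < d \<Longrightarrow> l \<noteq> k \<Longrightarrow> n l = m l"
  shows "unfold_col d n k i = unfold_col d m k j"
  unfolding unfold_col_def using assms by (intro sum.cong arg_cong2[where f = "(*)"] prod.cong) auto

text \<open>A single mode product is a transformation by identities in the other modes: a product
  of identity entries vanishes unless the two multi-indices agree in all these modes.\<close>

lemma mode_prod_eq_mode_map:
  assumes "k < d" "A \<in> carrier_mat p (m k)"
  shows "mode_prod d m k X A = mode_map d (m(k := p)) m ((\<lambda>l. 1\<^sub>m (m l))(k := A)) X"
proof
  fix i
  let ?A = "(\<lambda>l. 1\<^sub>m (m l))(k := A)"
  show "mode_prod d m k X A i = mode_map d (m(k := p)) m ?A X i"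
  proof (cases "i \<in> multi_indices d (m(k := p))")
    case i: True
    have ib: "i(k := b) \<in> multi_indices d m" if "b < m k" for b
      by (rule fun_upd_multi_indices[OF i]) (use assms that in auto)
    have lt: "unfold_col d m k i < (\<Prod>l\<in>{..<d} - {k}. m l)"
    proof -
      have "unfold_col d (m(k := p)) k i < (\<Prod>l\<in>{..<d} - {k}. (m(k := p)) l)"
        by (rule unfold_col_less) (use multi_indices_less[OF i] in auto)
      then show ?thesis by (simp add: unfold_col_cong[of d k i i "m(k := p)" m])
    qed
    have "mode_prod d m k X A i =
      (\<Sum>b<m k. A $$ (i k, b) * unfolding_mat d m k X $$ (b, unfold_col d m k i))"
      using i assms lt multi_indices_less[OF i assms(1)]
      by (simp add: mode_prod_def scalar_prod_def atLeast0LessThan unfolding_mat_def)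
    also have "\<dots> = (\<Sum>b<m k. A $$ (i k, b) * X (i(k := b)))"
    proof (intro sum.cong refl arg_cong2[where f = "(*)"])
      fix b assume "b \<in> {..<m k}"
      then show "unfolding_mat d m k X $$ (b, unfold_col d m k i) = X (i(k := b))"
        using unfolding_mat_entry(2)[OF ib assms(1), of b X] unfold_col_cong[of d k "i(k := b)" i
          m m]
        by simp
    qed
    also have "\<dots> = (\<Sum>j\<in>(\<lambda>b. i(k := b)) ` {..<m k}. (\<Prod>l<d. ?A l $$ (i l, j l)) * X j)"
    proof (subst sum.reindex)
      show "inj_on (\<lambda>b. i(k := b)) {..<m k}" by (auto intro!: inj_onI dest: fun_upd_eqD)
      have "(\<Prod>l<d. ?A l $$ (i l, (i(k := b)) l)) = A $$ (i k, b)" if "b < m k" for b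
      proof -
        have "(\<Prod>l<d. ?A l $$ (i l, (i(k := b)) l)) = (\<Prod>l<d. if l = k then A $$ (i k, b) else 1)"
          by (intro prod.cong refl) (use multi_indices_less[OF i] in fastforce)
        then show ?thesis using assms(1) by simp
      qed
      then show "(\<Sum>b<m k. A $$ (i k, b) * X (i(k := b))) =
          sum ((\<lambda>j. (\<Prod>l<d. ?A l $$ (i l, j l)) * X j) \<circ> (\<lambda>b. i(k := b))) {..<m k}"
        by simp
    qed
    also have "\<dots> = (\<Sum>j\<in>multi_indices d m. (\<Prod>l<d. ?A l $$ (i l, j l)) * X j)"
    proof (rule sum.mono_neutral_left)
      show "(\<lambda>b. i(k := b)) ` {..<m k} \<subseteq> multi_indices d m" using ib by auto
      show "\<forall>j\<in>multi_indices d m - (\<lambda>b. i(k := b)) ` {..<m k}. (\<Prod>l<d. ?A l $$ (i l, j l)) * X j = 0"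
      proof
        fix j assume j: "j \<in> multi_indices d m - (\<lambda>b. i(k := b)) ` {..<m k}"
        have "j k < m k" using j assms(1) by (auto simp: multi_indices_less)
        then have "j \<noteq> i(k := j k)" using j by blast
        then obtain l where l: "l < d" "j l \<noteq> (i(k := j k)) l"
          using j ib[OF \<open>j k < m k\<close>] unfolding multi_indices_def
            by (metis DiffD1 PiE_ext lessThan_iff)
        then have "l \<noteq> k" by auto
        then have "?A l $$ (i l, j l) = 0"
          using l j multi_indices_less[OF i l(1)] multi_indices_less[of j d m l] by simp
        then show "(\<Prod>l<d. ?A l $$ (i l, j l)) * X j = 0"
          using l(1) by (metis (mono_tags, lifting) finite_lessThan lessThan_iff mult_eq_0_iff
            prod_zero)
      qed
    qed simp
    finally show ?thesis using i by (simp add: mode_map_def)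
  qed (use assms in \<open>simp add: mode_prod_def mode_map_def\<close>)
qed

lemma mode_prods_eq_mode_map:
  assumes A: "\<And>k. k < d \<Longrightarrow> A k \<in> carrier_mat (n k) (m k)" and X: "X \<in> tensors d m"
  shows "mode_prods d m X A = mode_map d n m A X"
proof -
  \<comment> \<open>After \<open>k\<close> steps, identities stand in for the factors not yet applied.\<close>
  have "mode_prods_upto d m X A k = mode_map d (\<lambda>l. if l < k then n l else m l) m
      (\<lambda>l. if l < k then A l else 1\<^sub>m (m l)) X" if "k \<le> d" for k
    using that
  proof (induction k)
    case 0
    then show ?case using mode_map_one[OF X] by simp
  next
    case (Suc k)
    let ?m = "\<lambda>l. if l < k then dim_row (A l) else m l"
    let ?n = "\<lambda>l. if l < k then n l else m l"
    have eq: "mode_map d ?n m (\<lambda>l. if l < k then A l else 1\<^sub>m (m l)) X =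
        mode_map d ?m m (\<lambda>l. if l < k then A l else 1\<^sub>m (m l)) X"
      by (rule mode_map_cong) (use carrier_matD[OF A] Suc.prems in auto)
    have "mode_prods_upto d m X A (Suc k) =
        mode_map d (?m(k := n k)) ?m ((\<lambda>l. 1\<^sub>m (?m l))(k := A k))
          (mode_map d ?m m (\<lambda>l. if l < k then A l else 1\<^sub>m (m l)) X)"
      using Suc A[of k] eq by (simp add: mode_prod_eq_mode_map)
    also have "\<dots> = mode_map d (?m(k := n k)) m
        (\<lambda>l. ((\<lambda>l. 1\<^sub>m (?m l))(k := A k)) l * (if l < k then A l else 1\<^sub>m (m l))) X"
      by (rule mode_map_compose) (use A Suc.prems in auto)
    also have "\<dots> = mode_map d (\<lambda>l. if l < Suc k then n l else m l) m
        (\<lambda>l. if l < Suc k then A l else 1\<^sub>m (m l)) X"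
      by (rule mode_map_cong) (use A right_mult_one_mat[OF A[OF Suc_le_lessD[OF Suc.prems]]]
        Suc.prems in \<open>auto simp: less_Suc_eq\<close>)
    finally show ?case .
  qed
  from this[of d] have "mode_prods d m X A = mode_map d (\<lambda>l. if l < d then n l else m l) m
      (\<lambda>l. if l < d then A l else 1\<^sub>m (m l)) X" by (simp add: mode_prods_def)
  also have "\<dots> = mode_map d n m A X" by (rule mode_map_cong) auto
  finally show ?thesis .
qed

lemma mode_map_scale: "mode_map d n m A (tensor_scale c X) = tensor_scale c (mode_map d n m A X)"
  by (auto simp: mode_map_def tensor_scale_def sum_distrib_left fun_eq_iff algebra_simps)

lemma mode_map_add_factor:
  assumes "k < d" "B \<in> carrier_mat (n k) (m k)" "C \<in> carrier_mat (n k) (m k)"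
  shows "mode_map d n m (A(k := B + C)) X =
    mode_map d n m (A(k := B)) X + mode_map d n m (A(k := C)) X"
proof
  fix i
  show "mode_map d n m (A(k := B + C)) X i =
    (mode_map d n m (A(k := B)) X + mode_map d n m (A(k := C)) X) i"
  proof (cases "i \<in> multi_indices d n")
    case i: True
    have split: "(\<Prod>l<d. (A(k := D)) l $$ (i l, j l)) =
        D $$ (i k, j k) * (\<Prod>l\<in>{..<d} - {k}. A l $$ (i l, j l))" for D j
      using assms(1) by (subst prod.remove[of _ k]) auto
    have "(\<Prod>l<d. (A(k := B + C)) l $$ (i l, j l)) =
        (\<Prod>l<d. (A(k := B)) l $$ (i l, j l)) + (\<Prod>l<d. (A(k := C)) l $$ (i l, j l))"
      if "j \<in> multi_indices d m" for j
      using that assms multi_indices_less[OF i]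
        by (simp only: split) (auto simp: multi_indices_less algebra_simps)
    then show ?thesis using i by (simp add: mode_map_def plus_fun_def algebra_simps sum.distrib)
  qed (simp add: mode_map_def plus_fun_def)
qed

lemma mode_map_smult_factor:
  assumes "k < d" "B \<in> carrier_mat (n k) (m k)"
  shows "mode_map d n m (A(k := c \<cdot>\<^sub>m B)) X = tensor_scale c (mode_map d n m (A(k := B)) X)"
proof
  fix i
  show "mode_map d n m (A(k := c \<cdot>\<^sub>m B)) X i = tensor_scale c (mode_map d n m (A(k := B)) X) i"
  proof (cases "i \<in> multi_indices d n")
    case i: True
    have split: "(\<Prod>l<d. (A(k := D)) l $$ (i l, j l)) =
        D $$ (i k, j k) * (\<Prod>l\<in>{..<d} - {k}. A l $$ (i l, j l))" for D j
      using assms(1) by (subst prod.remove[of _ k]) auto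
    have "(\<Prod>l<d. (A(k := c \<cdot>\<^sub>m B)) l $$ (i l, j l)) = c * (\<Prod>l<d. (A(k := B)) l $$ (i l, j l))"
      if "j \<in> multi_indices d m" for j
      using that assms multi_indices_less[OF i]
        by (simp only: split) (auto simp: multi_indices_less)
    then show ?thesis using i
      by (simp add: mode_map_def tensor_scale_def sum_distrib_left mult.assoc)
  qed (simp add: mode_map_def tensor_scale_def)
qed

lemma mode_map_zero_factor:
  assumes "k < d" "A k = 0\<^sub>m (n k) (m k)"
  shows "mode_map d n m A X = 0"
proof
  fix i show "mode_map d n m A X i = 0 i"
  proof (cases "i \<in> multi_indices d n")
    case True
    have "(\<Prod>l<d. A l $$ (i l, j l)) = 0" if "j \<in> multi_indices d m" for j
      using assms multi_indices_less[OF True assms(1)] multi_indices_less[OF that assms(1)]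
      by (intro prod_zero bexI[of _ k]) auto
    then show ?thesis by (simp add: mode_map_def)
  qed (simp add: mode_map_def)
qed

lemma sum_apply: "(\<Sum>x\<in>A. f x) i = (\<Sum>x\<in>A. (f x i :: real))"
  by (induction A rule: infinite_finite_induct) (auto simp: plus_fun_def zero_fun_def)

text \<open>Distributing the product of the \<open>d\<close> sums of matrix entries leaves one term for each
  way of choosing a summand in every mode; \<open>e\<close> records the choice.\<close>

lemma mode_map_sum_expand:
  assumes A: "\<And>k. k < d \<Longrightarrow> A k \<in> carrier_mat (n k) (m k)"
    and B: "\<And>k. k < d \<Longrightarrow> B k \<in> carrier_mat (n k) (m k)"
  shows "mode_map d n m (\<lambda>k. A k + B k) X =
    (\<Sum>e\<in>(\<Pi>\<^sub>E k\<in>{..<d}. {0, 1}). mode_map d n m (\<lambda>k. if e k = (0::nat) then A k else B k) X)"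
    (is "_ = (\<Sum>e\<in>?E. _)")
proof
  fix i
  show "mode_map d n m (\<lambda>k. A k + B k) X i =
    (\<Sum>e\<in>?E. mode_map d n m (\<lambda>k. if e k = 0 then A k else B k) X) i"
  proof (cases "i \<in> multi_indices d n")
    case i: True
    have "(\<Prod>k<d. (A k + B k) $$ (i k, j k)) = (\<Sum>e\<in>?E. \<Prod>k<d. (if e k =
      0 then A k else B k) $$ (i k, j k))"
      if j: "j \<in> multi_indices d m" for j
    proof -
      have "(\<Prod>k<d. (A k + B k) $$ (i k, j k)) = (\<Prod>k<d. \<Sum>e\<in>{0::nat, 1}. (if e =
        0 then A k else B k) $$ (i k, j k))"
      proof (intro prod.cong refl)
        fix k assume "k \<in> {..<d}"
        then have k: "k < d" by simp
        show "(A k + B k) $$ (i k, j k) = (\<Sum>e\<in>{0::nat, 1}. (if e =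
          0 then A k else B k) $$ (i k, j k))"
          using A[OF k] B[OF k] multi_indices_less[OF i k] multi_indices_less[OF j k] by simp
      qed
      also have "\<dots> = (\<Sum>e\<in>?E. \<Prod>k<d. (if e k = 0 then A k else B k) $$ (i k, j k))"
        by (rule prod_sum_PiE) auto
      finally show ?thesis .
    qed
    then have "mode_map d n m (\<lambda>k. A k + B k) X i =
        (\<Sum>j\<in>multi_indices d m. \<Sum>e\<in>?E. (\<Prod>k<d. (if e k = 0 then A k else B k) $$ (i k, j k)) * X j)"
      using i by (simp add: mode_map_def sum_distrib_right)
    also have "\<dots> = (\<Sum>e\<in>?E. mode_map d n m (\<lambda>k. if e k = 0 then A k else B k) X i)"
      using i by (subst sum.swap) (simp add: mode_map_def)
    finally show ?thesis by (simp add: sum_apply)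
  qed (simp add: mode_map_def sum_apply)
qed


section \<open>Inner products and elementary tensors\<close>

lemma tensor_inner_commute: "tensor_inner d n X Y = tensor_inner d n Y X"
  by (simp add: tensor_inner_def mult.commute)

lemma tensor_inner_add_right: "tensor_inner d n W (X + Y) =
  tensor_inner d n W X + tensor_inner d n W Y"
  by (simp add: tensor_inner_def plus_fun_def algebra_simps sum.distrib)

lemma tensor_inner_scale_right: "tensor_inner d n W (tensor_scale c X) = c * tensor_inner d n W X"
  by (simp add: tensor_inner_def tensor_scale_def sum_distrib_left mult.left_commute)

lemma tensor_inner_scale_left: "tensor_inner d n (tensor_scale c X) W = c * tensor_inner d n X W"
  by (simp add: tensor_inner_def tensor_scale_def sum_distrib_left mult.assoc)

lemma tensor_inner_zero_right [simp]: "tensor_inner d n W 0 = 0"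
  by (simp add: tensor_inner_def zero_fun_def)

lemma tensor_inner_sum_right: "tensor_inner d n W (\<Sum>x\<in>A. f x) = (\<Sum>x\<in>A. tensor_inner d n W (f x))"
  by (simp add: tensor_inner_def sum_apply sum_distrib_left) (rule sum.swap)

lemma tensor_inner_sum_left: "tensor_inner d n (\<Sum>x\<in>A. f x) W = (\<Sum>x\<in>A. tensor_inner d n (f x) W)"
  by (simp add: tensor_inner_commute[of d n _ W] tensor_inner_sum_right)

lemma tensor_inner_self_zero:
  assumes "W \<in> tensors d n" "tensor_inner d n W W = 0"
  shows "W = 0"
proof
  fix i
  have "\<forall>i\<in>multi_indices d n. W i * W i = 0"
    using assms(2) unfolding tensor_inner_def by (subst (asm) sum_nonneg_eq_0_iff) auto
  then show "W i = 0 i" using assms(1) by (cases "i \<in> multi_indices d n") (auto simp: tensors_def)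
qed

lemma tensor_inner_cong: "(\<And>l. l < d \<Longrightarrow> n l = m l) \<Longrightarrow> tensor_inner d n = tensor_inner d m"
  unfolding tensor_inner_def using multi_indices_cong[of d n m] by simp

lemma mode_map_adjoint:
  assumes A: "\<And>k. k < d \<Longrightarrow> A k \<in> carrier_mat (n k) (m k)"
  shows "tensor_inner d n (mode_map d n m A X) Y =
    tensor_inner d m X (mode_map d m n (\<lambda>k. (A k)\<^sup>T) Y)"
proof -
  have "tensor_inner d n (mode_map d n m A X) Y =
      (\<Sum>i\<in>multi_indices d n. \<Sum>j\<in>multi_indices d m. (\<Prod>k<d. A k $$ (i k, j k)) * X j * Y i)"
    by (simp add: tensor_inner_def mode_map_def sum_distrib_right)
  also have "\<dots> =
    (\<Sum>j\<in>multi_indices d m. \<Sum>i\<in>multi_indices d n. (\<Prod>k<d. A k $$ (i k, j k)) * X j * Y i)"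
    by (rule sum.swap)
  also have "\<dots> = (\<Sum>j\<in>multi_indices d m. \<Sum>i\<in>multi_indices d n.
      X j * ((\<Prod>k<d. (A k)\<^sup>T $$ (j k, i k)) * Y i))"
  proof (intro sum.cong refl)
    fix i j assume "j \<in> multi_indices d m" "i \<in> multi_indices d n"
    then have "(\<Prod>k<d. (A k)\<^sup>T $$ (j k, i k)) = (\<Prod>k<d. A k $$ (i k, j k))"
      by (intro prod.cong refl) (metis A carrier_matD index_transpose_mat(1) lessThan_iff
        multi_indices_less)
    then show "(\<Prod>k<d. A k $$ (i k, j k)) * X j * Y i = X j * ((\<Prod>k<d. (A k)\<^sup>T $$ (j k, i k)) * Y i)"
      by simp
  qed
  also have "\<dots> = tensor_inner d m X (mode_map d m n (\<lambda>k. (A k)\<^sup>T) Y)"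
    by (simp add: tensor_inner_def mode_map_def sum_distrib_left)
  finally show ?thesis .
qed

lemma tensor_scale_tensors [simp]: "X \<in> tensors d n \<Longrightarrow> tensor_scale c X \<in> tensors d n"
  by (simp add: tensors_def tensor_scale_def)

lemma add_tensors: "X \<in> tensors d n \<Longrightarrow> Y \<in> tensors d n \<Longrightarrow> X + Y \<in> tensors d n"
  by (simp add: tensors_def plus_fun_def)

lemma sum_tensors: "(\<And>x. x \<in> A \<Longrightarrow> f x \<in> tensors d n) \<Longrightarrow> (\<Sum>x\<in>A. f x) \<in> tensors d n"
  by (auto simp: tensors_def sum_apply intro!: sum.neutral)

lemma elementary_tensor_tensors [simp]: "elementary_tensor d n v \<in> tensors d n"
  by (simp add: elementary_tensor_def tensors_def)

text \<open>By this expansion, orthogonality to the elementary tensors of the columns implies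
  orthogonality to all transformed tensors.\<close>

lemma mode_map_eq_sum_elementary:
  assumes A: "\<And>k. k < d \<Longrightarrow> A k \<in> carrier_mat (n k) (m k)"
  shows "mode_map d n m A X =
    (\<Sum>j\<in>multi_indices d m. tensor_scale (X j) (elementary_tensor d n (\<lambda>k. col (A k) (j k))))"
proof
  fix i
  have "(\<Prod>k<d. A k $$ (i k, j k)) = (\<Prod>k<d. col (A k) (j k) $ i k)"
    if "i \<in> multi_indices d n" "j \<in> multi_indices d m" for j
    using that by (intro prod.cong refl) (metis A carrier_matD index_col lessThan_iff
      multi_indices_less)
  then show "mode_map d n m A X i =
      (\<Sum>j\<in>multi_indices d m. tensor_scale (X j) (elementary_tensor d n (\<lambda>k. col (A k) (j k)))) i"
    by (simp add: mode_map_def sum_apply tensor_scale_def elementary_tensor_def mult.commute)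
qed

text \<open>An elementary tensor is a core of dimensions \<open>1\<close> transformed by single columns, so
  that facts about ranks and unfoldings of transformed tensors apply to it.\<close>

lemma elementary_tensor_eq_mode_map:
  "elementary_tensor d n v =
    mode_map d n (\<lambda>k. 1) (\<lambda>k. mat (n k) 1 (\<lambda>(a, b). v k $ a)) (\<lambda>i. 1)"
proof
  fix i
  have one: "multi_indices d (\<lambda>k. 1) = {\<lambda>k\<in>{..<d}. 0}"
    unfolding multi_indices_def PiE_eq_singleton by auto
  have "(\<Prod>k<d. mat (n k) 1 (\<lambda>(a, b). v k $ a) $$ (i k, (\<lambda>k\<in>{..<d}. 0) k)) = (\<Prod>k<d. v k $ i k)"
    if "i \<in> multi_indices d n"
    by (intro prod.cong refl) (simp add: multi_indices_less[OF that])
  then show "elementary_tensor d n v i =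
      mode_map d n (\<lambda>k. 1) (\<lambda>k. mat (n k) 1 (\<lambda>(a, b). v k $ a)) (\<lambda>i. 1) i"
    unfolding mode_map_def one elementary_tensor_def by simp
qed

lemma inner_elementary:
  assumes "\<And>k. k < d \<Longrightarrow> v k \<in> carrier_vec (n k)"
  shows "tensor_inner d n (elementary_tensor d n u) (elementary_tensor d n v) = (\<Prod>k<d. u k \<bullet> v k)"
proof -
  have "tensor_inner d n (elementary_tensor d n u) (elementary_tensor d n v) =
      (\<Sum>i\<in>multi_indices d n. \<Prod>k<d. u k $ i k * v k $ i k)"
    by (simp add: tensor_inner_def elementary_tensor_def prod.distrib)
  also have "\<dots> = (\<Prod>k<d. \<Sum>b<n k. u k $ b * v k $ b)" by (rule sum_multi_indices_prod)
  also have "\<dots> = (\<Prod>k<d. u k \<bullet> v k)"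
    by (intro prod.cong refl) (auto simp: scalar_prod_def atLeast0LessThan dest!: assms
      carrier_vecD)
  finally show ?thesis .
qed

lemma inner_mode_map_elementary:
  assumes "\<And>k. k < d \<Longrightarrow> A k \<in> carrier_mat (n k) (m k)" "\<And>k. k < d \<Longrightarrow> v k \<in> carrier_vec (n k)"
  shows "tensor_inner d n (mode_map d n m A X) (elementary_tensor d n v) =
    (\<Sum>j\<in>multi_indices d m. X j * (\<Prod>k<d. col (A k) (j k) \<bullet> v k))"
  using mode_map_eq_sum_elementary[of d A n m X, OF assms(1)]
  by (simp add: tensor_inner_sum_left tensor_inner_scale_left inner_elementary assms(2))

lemma inner_mode_map_zero:
  assumes A: "\<And>k. k < d \<Longrightarrow> A k \<in> carrier_mat (n k) (m k)"
    and cols: "\<And>k b. k < d \<Longrightarrow> b < m k \<Longrightarrow> col (A k) b \<in> S k"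
    and W: "\<And>v. (\<And>k. k < d \<Longrightarrow> v k \<in> S k) \<Longrightarrow> tensor_inner d n W (elementary_tensor d n v) = 0"
  shows "tensor_inner d n W (mode_map d n m A Z) = 0"
proof -
  have "tensor_inner d n W (elementary_tensor d n (\<lambda>k. col (A k) (j k))) = 0"
    if "j \<in> multi_indices d m" for j
    by (rule W) (use cols multi_indices_less[OF that] in auto)
  then show ?thesis
    using mode_map_eq_sum_elementary[of d A n m Z, OF A]
    by (simp add: tensor_inner_sum_right tensor_inner_scale_right)
qed

lemma tensor_orth_prod_subspace:
  "W \<in> tensor_orth d n (tensor_prod_subspace d n S) \<longleftrightarrow>
    W \<in> tensors d n \<and>
    (\<forall>v. (\<forall>k<d. v k \<in> S k) \<longrightarrow> tensor_inner d n W (elementary_tensor d n v) = 0)" (is "?l \<longleftrightarrow> ?r")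
proof
  assume ?l
  then show ?r by (auto simp: tensor_orth_def tensor_prod_subspace_def intro: tensor.span_base)
next
  assume r: ?r
  have "tensor_inner d n W V = 0" if "V \<in> tensor_prod_subspace d n S" for V
    using that unfolding tensor_prod_subspace_def
  proof (induction V rule: tensor.span_induct_alt)
    case base
    show ?case by (rule tensor_inner_zero_right)
  next
    case (step c V V')
    then show ?case using r unfolding tensor_inner_add_right tensor_inner_scale_right by auto
  qed
  then show ?l using r by (auto simp: tensor_orth_def)
qed


section \<open>Products and ranks of matrices\<close>

lemma mult_mat_entry:
  assumes "(A :: real mat) \<in> carrier_mat n r" "B \<in> carrier_mat r m" "a < n" "b < m"
  shows "(A * B) $$ (a, b) = (\<Sum>c<r. A $$ (a, c) * B $$ (c, b))"
  using assms by (simp add: scalar_prod_def atLeast0LessThan)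

lemma rank_mult_le_left:
  assumes A: "(A :: real mat) \<in> carrier_mat n r" and B: "B \<in> carrier_mat r m"
  shows "vec_space.rank n (A * B) \<le> vec_space.rank n A"
proof -
  interpret vec_space "TYPE(real)" n .
  have AB: "A * B \<in> carrier_mat n m" using A B by simp
  have "span (set (cols (A * B))) \<subseteq> span (set (cols A))"
  proof -
    have "\<exists>x\<in>carrier_vec r. A *\<^sub>v x = A * B *\<^sub>v y" if "y \<in> carrier_vec m" for y
      using A B that by (intro bexI[of _ "B *\<^sub>v y"]) auto
    then have "col_space (A * B) \<subseteq> col_space A"
      using A B AB by (auto simp: col_space_eq[OF AB] col_space_eq[OF A])
    then show ?thesis by (simp add: col_space_def)
  qed
  moreover have "VectorSpace.subspace class_ring (span (set (cols (A * B)))) V"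
    "VectorSpace.subspace class_ring (span (set (cols A))) V"
    using A AB cols_dim by (metis carrier_matD(1) span_is_subspace)+
  moreover have "vectorspace.fin_dim class_ring (span_vs (set (cols A)))"
    "vectorspace.fin_dim class_ring (span_vs (set (cols (A * B))))"
    using fin_dim_span_cols A AB by blast+
  ultimately show ?thesis
    unfolding rank_def
    using vectorspace.subspace_dim[OF subspace_is_vs nested_subspaces] by auto
qed

text \<open>If the determinant did not vanish, \<open>Y * R\<close> would have \<open>p\<close> independent columns in the
  column space of \<open>Y\<close>. With \<open>L\<close> and \<open>R\<close> selecting rows and columns, these are the minors of order
  \<open>p\<close>; below, \<open>L\<close> and \<open>R\<close> form linear combinations instead.\<close>

lemma det_mult_low_rank_zero:
  assumes L: "(L :: real mat) \<in> carrier_mat p n" and Y: "Y \<in> carrier_mat n m"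
    and R: "R \<in> carrier_mat m p"
    and rank: "vec_space.rank n Y < p"
  shows "det (L * Y * R) = 0"
proof (rule ccontr)
  assume det: "det (L * Y * R) \<noteq> 0"
  interpret vec_space "TYPE(real)" n .
  have M: "L * Y * R \<in> carrier_mat p p" and YR: "Y * R \<in> carrier_mat n p"
    and eq: "L * Y * R = L * (Y * R)"
    using L Y R by (auto simp: assoc_mult_mat)
  have dist: "distinct (cols (Y * R))"
  proof (rule ccontr)
    assume "\<not> distinct (cols (Y * R))"
    then obtain i j where ij: "i < p" "j < p" "i \<noteq> j" "col (Y * R) i = col (Y * R) j"
      using YR by (auto simp: distinct_conv_nth)
    have "col (L * Y * R) i = col (L * Y * R) j"
      unfolding eq using ij L YR by (metis col_mult2)
    then show False using det_identical_cols[OF M ij(3,1,2)] det by simp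
  qed
  have "lin_indpt (set (cols (Y * R)))"
  proof
    assume "lin_dep (set (cols (Y * R)))"
    then obtain v where v: "v \<in> carrier_vec p" "v \<noteq> 0\<^sub>v p" "Y * R *\<^sub>v v = 0\<^sub>v n"
      using lin_depE[OF YR _ dist] by blast
    then have "L * Y * R *\<^sub>v v = 0\<^sub>v p" unfolding eq using L YR
      by (simp add: assoc_mult_mat_vec[of _ p n _ p]) (auto intro!: eq_vecI)
    then show False using v det det_0_iff_vec_prod_zero_field[OF M] by blast
  qed
  then have "rank (Y * R) = p" using lin_indpt_full_rank[OF YR dist] by simp
  moreover have "rank (Y * R) \<le> rank Y" by (rule rank_mult_le_left[OF Y R])
  ultimately show False using rank by simp
qed

text \<open>Among the columns of \<open>U * H\<close> there are \<open>s\<close> independent ones. The corresponding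
  columns of \<open>H\<close> form an invertible matrix, since a vector in its kernel would give a dependency.\<close>

lemma right_inverse_of_full_rank_factor:
  assumes U: "(U :: real mat) \<in> carrier_mat n s" and H: "H \<in> carrier_mat s m"
    and rank: "vec_space.rank n (U * H) = s"
  obtains R where "R \<in> carrier_mat m s" "H * R = 1\<^sub>m s"
proof -
  interpret vec_space "TYPE(real)" n .
  let ?X = "U * H"
  have X: "?X \<in> carrier_mat n m" using U H by simp
  obtain S where S: "maximal S (\<lambda>T. T \<subseteq> set (cols ?X) \<and> lin_indpt T)" "finite S"
    using maximal_exists_superset[of "set (cols ?X)" "(\<lambda>T. T \<subseteq> set (cols ?X) \<and> lin_indpt T)" "{}"]
    by (metis (no_types, lifting) List.finite_set empty_subsetI finite_lin_indpt2 empty_iff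
      finite.emptyI)
  then have card: "card S = s" using rank_card_indpt[OF X] rank by simp
  have sub: "S \<subseteq> set (cols ?X)" and indpt: "lin_indpt S" using S by (auto simp: maximal_def)
  obtain xs where xs: "set xs = S" "distinct xs" using S(2) finite_distinct_list by blast
  then have len: "length xs = s" using card distinct_card by fastforce
  have "\<forall>b<s. \<exists>c<m. xs ! b = col ?X c"
  proof (intro allI impI)
    fix b assume "b < s"
    then have "xs ! b \<in> set (cols ?X)" using xs len sub by auto
    then show "\<exists>c<m. xs ! b = col ?X c" using X
      by (metis carrier_matD(2) cols_length cols_nth in_set_conv_nth)
  qed
  then obtain f where f: "\<And>b. b < s \<Longrightarrow> f b < m" "\<And>b. b < s \<Longrightarrow> xs ! b = col ?X (f b)" by metis
  \<comment> \<open>Multiplication by \<open>E\<close> from the right selects the independent columns.\<close>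
  define E where "E = mat m s (\<lambda>(a, b). if a = f b then 1 else (0::real))"
  have E: "E \<in> carrier_mat m s" by (simp add: E_def)
  have XE: "?X * E \<in> carrier_mat n s" using X E by simp
  have "col (?X * E) b = xs ! b" if b: "b < s" for b
  proof (rule eq_vecI)
    fix a assume "a < dim_vec (xs ! b)"
    then have a: "a < n" using f[OF b] carrier_matD[OF X] by (simp del: index_mult_mat)
    have "(?X * E) $$ (a, b) = (\<Sum>c<m. ?X $$ (a, c) * E $$ (c, b))"
      by (rule mult_mat_entry[OF X E a b])
    also have "\<dots> = (\<Sum>c<m. if c = f b then ?X $$ (a, c) else 0)"
      using b by (intro sum.cong) (auto simp: E_def)
    finally show "col (?X * E) b $ a = xs ! b $ a"
      using a b f[OF b] carrier_matD[OF XE] carrier_matD[OF X]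
      by (simp del: index_mult_mat col_mult2 assoc_mult_mat)
  qed (use b f XE X in simp)
  then have cols: "cols (?X * E) = xs" using XE len by (auto intro!: nth_equalityI)
  have HE: "H * E \<in> carrier_mat s s" using H E by simp
  have "det (H * E) \<noteq> 0"
  proof
    assume "det (H * E) = 0"
    then obtain v where v: "v \<in> carrier_vec s" "v \<noteq> 0\<^sub>v s" "H * E *\<^sub>v v = 0\<^sub>v s"
      using det_0_iff_vec_prod_zero_field[OF HE] by blast
    have "?X * E *\<^sub>v v = U *\<^sub>v (H * E *\<^sub>v v)"
      unfolding assoc_mult_mat[OF U H E] by (rule assoc_mult_mat_vec[OF U HE v(1)])
    moreover have "U *\<^sub>v 0\<^sub>v s = 0\<^sub>v n" using U by (intro eq_vecI) auto
    ultimately have "?X * E *\<^sub>v v = 0\<^sub>v n" by (simp only: v(3))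
    then have "lin_dep (set (cols (?X * E)))" using lin_depI[OF XE v(1,2)] cols xs by simp
    then show False using indpt cols xs by simp
  qed
  then obtain K where K: "K \<in> carrier_mat s s" "H * E * K = 1\<^sub>m s"
    using det_non_zero_imp_unit[OF HE] HE
    by (auto simp: Units_def ring_mat_def)
  show ?thesis
  proof
    show "E * K \<in> carrier_mat m s" using E K by simp
    show "H * (E * K) = 1\<^sub>m s" using K(2) unfolding assoc_mult_mat[OF H E K(1)] .
  qed
qed

text \<open>The sum is the trace pairing of \<open>A\<close> with \<open>F * B\<close>, that is of \<open>A * B\<^sup>T\<close> with \<open>F\<close>; the
  pairing is definite.\<close>

lemma mult_transpose_zero_iff:
  fixes A B :: "real mat"
  assumes A: "A \<in> carrier_mat n m" and B: "B \<in> carrier_mat s m"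
  shows "A * B\<^sup>T = 0\<^sub>m n s \<longleftrightarrow>
    (\<forall>F\<in>carrier_mat n s. (\<Sum>a<n. \<Sum>c<m. A $$ (a, c) * (F * B) $$ (a, c)) = 0)"
proof -
  have AB: "A * B\<^sup>T \<in> carrier_mat n s" using A B by simp
  have eq: "(\<Sum>a<n. \<Sum>c<m. A $$ (a, c) * (F * B) $$ (a, c)) =
    (\<Sum>a<n. \<Sum>b<s. (A * B\<^sup>T) $$ (a, b) * F $$ (a, b))"
    if F: "F \<in> carrier_mat n s" for F
  proof (rule sum.cong[OF refl])
    fix a assume "a \<in> {..<n}"
    then have a: "a < n" by simp
    have "(\<Sum>c<m. A $$ (a, c) * (F * B) $$ (a, c)) =
      (\<Sum>c<m. \<Sum>b<s. A $$ (a, c) * (F $$ (a, b) * B $$ (b, c)))"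
      using a F B by (simp add: scalar_prod_def atLeast0LessThan sum_distrib_left)
    also have "\<dots> = (\<Sum>b<s. \<Sum>c<m. A $$ (a, c) * (F $$ (a, b) * B $$ (b, c)))" by (rule sum.swap)
    also have "\<dots> = (\<Sum>b<s. (A * B\<^sup>T) $$ (a, b) * F $$ (a, b))"
      using a A B
        by (simp add: scalar_prod_def atLeast0LessThan sum_distrib_right mult.assoc
        mult.commute[of "F $$ _"])
    finally show "(\<Sum>c<m. A $$ (a, c) * (F * B) $$ (a, c)) =
      (\<Sum>b<s. (A * B\<^sup>T) $$ (a, b) * F $$ (a, b))" .
  qed
  show ?thesis
  proof
    assume "A * B\<^sup>T = 0\<^sub>m n s"
    then show "\<forall>F\<in>carrier_mat n s. (\<Sum>a<n. \<Sum>c<m. A $$ (a, c) * (F * B) $$ (a, c)) = 0"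
      by (simp add: eq)
  next
    assume "\<forall>F\<in>carrier_mat n s. (\<Sum>a<n. \<Sum>c<m. A $$ (a, c) * (F * B) $$ (a, c)) = 0"
    \<comment> \<open>Test with \<open>F = A * B\<^sup>T\<close>.\<close>
    then have "(\<Sum>a<n. \<Sum>b<s. (A * B\<^sup>T) $$ (a, b) * (A * B\<^sup>T) $$ (a, b)) = 0"
      using eq[OF AB] AB by simp
    then have "\<forall>a<n. \<forall>b<s. (A * B\<^sup>T) $$ (a, b) = 0"
      by (simp add: sum_nonneg_eq_0_iff sum_nonneg del: index_mult_mat)
    then show "A * B\<^sup>T = 0\<^sub>m n s" using AB by (intro eq_matI) (auto simp del: index_mult_mat)
  qed
qed

lemma mat_span_eq:
  assumes "A \<in> carrier_mat n m"
  shows "mat_span A = {A *\<^sub>v x | x. x \<in> carrier_vec m}"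
proof -
  interpret vec_space "TYPE(real)" n .
  show ?thesis using assms col_space_eq[OF assms] by (auto simp: mat_span_def)
qed

lemma col_in_mat_span:
  assumes A: "A \<in> carrier_mat n m" and b: "b < m"
  shows "col A b \<in> mat_span A"
proof -
  have "A *\<^sub>v unit_vec m b = col A b"
  proof (rule eq_vecI)
    fix a assume "a < dim_vec (col A b)"
    then have a: "a < n" using A by simp
    have "(A *\<^sub>v unit_vec m b) $ a = (\<Sum>j<m. A $$ (a, j) * unit_vec m b $ j)"
      using A a by (simp add: scalar_prod_def atLeast0LessThan)
    also have "\<dots> = (\<Sum>j<m. if j = b then A $$ (a, j) else 0)"
      using b by (intro sum.cong) auto
    finally show "(A *\<^sub>v unit_vec m b) $ a = col A b $ a" using A b a by simp
  qed (use A in simp)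
  then show ?thesis unfolding mat_span_eq[OF A] by (intro CollectI exI[of _ "unit_vec m b"]) simp
qed


section \<open>Orthonormal frames\<close>

lemma stiefelD:
  assumes "U \<in> stiefel s n"
  shows "U \<in> carrier_mat n s" "U\<^sup>T * U = 1\<^sub>m s"
  using assms by (auto simp: stiefel_def)

lemma proj_perp_props:
  assumes U: "U \<in> stiefel s n"
  shows "proj_perp U \<in> carrier_mat n n" "proj_perp U * U = 0\<^sub>m n s" "U\<^sup>T * proj_perp U = 0\<^sub>m s n"
    "(proj_perp U)\<^sup>T = proj_perp U"
proof -
  have Uc: "U \<in> carrier_mat n s" and UU: "U\<^sup>T * U = 1\<^sub>m s" using stiefelD[OF U] by auto
  then have P: "proj_perp U = 1\<^sub>m n - U * U\<^sup>T" by (simp add: proj_perp_def)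
  show "proj_perp U \<in> carrier_mat n n" using Uc unfolding P
    by (auto intro!: minus_carrier_mat mult_carrier_mat)
  have "U * U\<^sup>T * U = U" using Uc UU by (simp add: assoc_mult_mat[of U n s])
  then show "proj_perp U * U = 0\<^sub>m n s"
    unfolding P using Uc by (simp add: minus_mult_distrib_mat[of _ n n])
  have "U\<^sup>T * (U * U\<^sup>T) = U\<^sup>T"
    using Uc by (simp add: assoc_mult_mat[of _ s n U s _ n, symmetric] UU del: assoc_mult_mat)
  then show "U\<^sup>T * proj_perp U = 0\<^sub>m s n"
    unfolding P using Uc by (simp add: mult_minus_distrib_mat[of _ s n _ n])
  show "(proj_perp U)\<^sup>T = proj_perp U"
    unfolding P using Uc by (simp add: transpose_minus[of _ n n] transpose_mult[of _ n s])
qed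

text \<open>The columns of \<open>proj_perp U\<close> are orthogonal to the span of \<open>U\<close>, hence lie in the span
  of \<open>U'\<close>, where \<open>U' * U'\<^sup>T\<close> acts as the identity; and \<open>U'\<^sup>T * proj_perp U = U'\<^sup>T\<close>.\<close>

lemma stiefel_complement:
  assumes U: "U \<in> stiefel s n" and U': "U' \<in> stiefel q n"
    and span: "mat_span U' = vec_orth n (mat_span U)"
  shows "U * U\<^sup>T + U' * U'\<^sup>T = 1\<^sub>m n" "U'\<^sup>T * U = 0\<^sub>m q s" "proj_perp U = U' * U'\<^sup>T"
proof -
  have Uc: "U \<in> carrier_mat n s" and U'c: "U' \<in> carrier_mat n q" and UU': "U'\<^sup>T * U' = 1\<^sub>m q"
    using stiefelD[OF U] stiefelD[OF U'] by auto
  have P: "proj_perp U \<in> carrier_mat n n" "U\<^sup>T * proj_perp U = 0\<^sub>m s n"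
    using proj_perp_props[OF U] by auto
  note colU = col_in_mat_span[OF Uc] and colU' = col_in_mat_span[OF U'c]
  show orth: "U'\<^sup>T * U = 0\<^sub>m q s"
  proof (rule eq_matI)
    fix a b assume "a < dim_row (0\<^sub>m q s)" "b < dim_col (0\<^sub>m q s)"
    then have ab: "a < q" "b < s" by auto
    have "col U' a \<bullet> col U b = 0" using colU'[OF ab(1)] colU[OF ab(2)] unfolding span vec_orth_def
      by auto
    then show "(U'\<^sup>T * U) $$ (a, b) = 0\<^sub>m q s $$ (a, b)" using ab Uc U'c by simp
  qed (use Uc U'c in auto)
  have "\<forall>b<n. \<exists>x. x \<in> carrier_vec q \<and> col (proj_perp U) b = U' *\<^sub>v x"
  proof (intro allI impI)
    fix b assume b: "b < n"
    have "col (proj_perp U) b \<in> vec_orth n (mat_span U)"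
      unfolding vec_orth_def
    proof (intro CollectI conjI ballI)
      show "col (proj_perp U) b \<in> carrier_vec n" using P b by simp
      fix u assume "u \<in> mat_span U"
      then obtain x where x: "x \<in> carrier_vec s" "u = U *\<^sub>v x" unfolding mat_span_eq[OF Uc] by auto
      have "U\<^sup>T *\<^sub>v col (proj_perp U) b = col (U\<^sup>T * proj_perp U) b" using P(1) Uc b
        by (subst col_mult2[of _ s n]) auto
      also have "\<dots> = 0\<^sub>v s" using b by (simp add: P(2))
      finally have "x \<bullet> (U\<^sup>T *\<^sub>v col (proj_perp U) b) = 0" using x by simp
      moreover have "x \<bullet> (U\<^sup>T *\<^sub>v col (proj_perp U) b) = (U *\<^sub>v x) \<bullet> col (proj_perp U) b"
        using x Uc P(1) b
          by (metis carrier_matD(1) col_dim transpose_vec_mult_scalar transpose_carrier_mat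
          transpose_transpose)
      ultimately show "col (proj_perp U) b \<bullet> u = 0"
        using x Uc P(1) b by (metis carrier_matD(1) col_dim comm_scalar_prod mult_mat_vec_carrier)
    qed
    then have "col (proj_perp U) b \<in> mat_span U'" by (simp add: span)
    then show "\<exists>x. x \<in> carrier_vec q \<and> col (proj_perp U) b = U' *\<^sub>v x"
      unfolding mat_span_eq[OF U'c] by auto
  qed
  then obtain x where x: "\<And>b. b < n \<Longrightarrow> x b \<in> carrier_vec q" "\<And>b. b < n \<Longrightarrow> col (proj_perp U) b =
    U' *\<^sub>v x b"
    by metis
  define C where "C = mat_of_cols q (map x [0..<n])"
  have C: "C \<in> carrier_mat q n" using mat_of_cols_carrier(1)[of q "map x [0..<n]"]
    by (simp add: C_def)
  have PC: "proj_perp U = U' * C"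
  proof (rule mat_col_eqI)
    fix b assume "b < dim_col (U' * C)"
    then have b: "b < n" using C by simp
    have "col C b = x b" unfolding C_def using b x(1)[OF b] by (subst col_mat_of_cols) auto
    then show "col (proj_perp U) b = col (U' * C) b"
      using x(2)[OF b] col_mult2[OF U'c C b] by (simp only:)
  qed (use U'c P C in auto)
  have U'T: "U'\<^sup>T \<in> carrier_mat q n" using U'c by simp
  have "U'\<^sup>T * proj_perp U = C"
    unfolding PC assoc_mult_mat[OF U'T U'c C, symmetric] UU' using C by simp
  then have 1: "U' * U'\<^sup>T * proj_perp U = proj_perp U"
    unfolding assoc_mult_mat[OF U'c U'T P(1)] by (simp add: PC)
  have "U' * U'\<^sup>T * proj_perp U = U' * (U'\<^sup>T * proj_perp U)"
    by (rule assoc_mult_mat[OF U'c U'T P(1)])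
  also have "U'\<^sup>T * proj_perp U = U'\<^sup>T - (U'\<^sup>T * U) * U\<^sup>T"
    using Uc U'c
      by (simp add: proj_perp_def mult_minus_distrib_mat[of _ q n _ n] assoc_mult_mat[of _ q n])
  also have "\<dots> = U'\<^sup>T" unfolding orth using Uc U'c by (intro eq_matI) auto
  finally show 2: "proj_perp U = U' * U'\<^sup>T" using 1 by simp
  show "U * U\<^sup>T + U' * U'\<^sup>T = 1\<^sub>m n"
    unfolding 2[symmetric] using Uc by (intro eq_matI) (auto simp: proj_perp_def)
qed


section \<open>Limits of low-rank matrices\<close>

lemma tendsto_det:
  fixes M :: "nat \<Rightarrow> real mat"
  assumes "\<And>i. M i \<in> carrier_mat n n" "L \<in> carrier_mat n n"
    and "\<And>a b. a < n \<Longrightarrow> b < n \<Longrightarrow> (\<lambda>i. M i $$ (a, b)) \<longlonglongrightarrow> L $$ (a, b)"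
  shows "(\<lambda>i. det (M i)) \<longlonglongrightarrow> det L"
  unfolding det_def'[OF assms(1)] det_def'[OF assms(2)]
  by (intro tendsto_sum tendsto_mult tendsto_const tendsto_prod assms(3))
    (use permutes_in_image in fastforce)+

lemma tendsto_mult_mat:
  fixes Y :: "nat \<Rightarrow> real mat"
  assumes A: "A \<in> carrier_mat p n" and Y: "\<And>i. Y i \<in> carrier_mat n m" and Z: "Z \<in> carrier_mat n m"
    and B: "B \<in> carrier_mat m q"
    and lim: "\<And>a c. a < n \<Longrightarrow> c < m \<Longrightarrow> (\<lambda>i. Y i $$ (a, c)) \<longlonglongrightarrow> Z $$ (a, c)"
    and "a < p" "b < q"
  shows "(\<lambda>i. (A * Y i * B) $$ (a, b)) \<longlonglongrightarrow> (A * Z * B) $$ (a, b)"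
proof -
  have eq: "(A * W * B) $$ (a, b) = (\<Sum>c<m. (\<Sum>k<n. A $$ (a, k) * W $$ (k, c)) * B $$ (c, b))"
    if "W \<in> carrier_mat n m" for W
  proof -
    have "A * W \<in> carrier_mat p m" using A that by simp
    then have "(A * W * B) $$ (a, b) = (\<Sum>c<m. (A * W) $$ (a, c) * B $$ (c, b))"
      using B assms(6,7) carrier_matD[of "A * W"]
      by (simp add: index_mult_mat(1)[of _ "A * W"] scalar_prod_def atLeast0LessThan del:
        index_mult_mat(1))
    also have "\<dots> = (\<Sum>c<m. (\<Sum>k<n. A $$ (a, k) * W $$ (k, c)) * B $$ (c, b))"
      using A that assms(6) by (simp add: scalar_prod_def atLeast0LessThan)
    finally show ?thesis .
  qed
  show ?thesis
    unfolding eq[OF Y] eq[OF Z]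
    by (intro tendsto_sum tendsto_mult tendsto_const lim) auto
qed

text \<open>The heart of the matter, for matrices: if \<open>V\<close> is tangent at \<open>U * H\<close> to the matrices
  of rank at most \<open>s\<close>, then the part of \<open>V\<close> orthogonal to \<open>U\<close> has its rows in the row space of
  \<open>H\<close>. As \<open>1 - R * H\<close> projects to the kernel of \<open>H\<close>, it suffices that
  \<open>proj_perp U * V * (1 - R * H)\<close> vanishes. Border the \<open>s\<close>-by-\<open>s\<close> matrix \<open>U\<^sup>T * Y i * R\<close> by a row
  of \<open>proj_perp U\<close>, divided by \<open>t i\<close>, and a column of \<open>1 - R * H\<close>. The bordered determinants
  vanish by the rank bound, and they tend to the determinant of a lower triangular matrix with
  diagonal \<open>1, \<dots>, 1, x\<close>, where \<open>x\<close> is an entry of that product.\<close>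

lemma tangent_of_low_rank_matrices:
  fixes Y :: "nat \<Rightarrow> real mat"
  assumes U: "U \<in> stiefel s n" and H: "H \<in> carrier_mat s m"
    and R: "R \<in> carrier_mat m s" "H * R = 1\<^sub>m s"
    and Y: "\<And>i. Y i \<in> carrier_mat n m" "\<And>i. vec_space.rank n (Y i) \<le> s" and V: "V \<in> carrier_mat n m"
    and t: "\<And>i. t i > (0::real)"
    and lim: "\<And>a c. a < n \<Longrightarrow> c < m \<Longrightarrow> (\<lambda>i. Y i $$ (a, c)) \<longlonglongrightarrow> (U * H) $$ (a, c)"
    and limV: "\<And>a c. a < n \<Longrightarrow> c < m \<Longrightarrow> (\<lambda>i. 1 / t i * (Y i $$ (a, c) - (U * H) $$ (a, c))) \<longlonglongrightarrow>
      V $$ (a, c)"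
  shows "proj_perp U * V = proj_perp U * V * R * H"
proof -
  let ?P = "proj_perp U" and ?X = "U * H"
  define N where "N = 1\<^sub>m m - R * H"
  have Uc: "U \<in> carrier_mat n s" and UU: "U\<^sup>T * U = 1\<^sub>m s" using stiefelD[OF U] by auto
  have P: "?P \<in> carrier_mat n n" and PU: "?P * U = 0\<^sub>m n s" using proj_perp_props[OF U] by auto
  have N: "N \<in> carrier_mat m m" using R H unfolding N_def
    by (auto intro!: minus_carrier_mat mult_carrier_mat)
  have HN: "H * N = 0\<^sub>m s m"
    using mult_minus_distrib_mat[OF H one_carrier_mat mult_carrier_mat[OF R(1) H]] R H
    by (simp add: N_def assoc_mult_mat[OF H R(1) H, symmetric] del: assoc_mult_mat)
  have PV: "?P * V \<in> carrier_mat n m" using P V by simp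
  have X: "?X \<in> carrier_mat n m" using Uc H by simp
  have PX: "?P * ?X = 0\<^sub>m n m" using H unfolding assoc_mult_mat[OF P Uc H, symmetric] PU by simp
  have UX: "U\<^sup>T * ?X = H"
    using H Uc by (simp add: assoc_mult_mat[OF _ Uc H, of _ s, symmetric] UU del: assoc_mult_mat)
  have zero: "(?P * V * N) $$ (a, j) = 0" if a: "a < n" and j: "j < m" for a j
  proof -
    define R' where "R' = mat m (Suc s) (\<lambda>(c, b). if b < s then R $$ (c, b) else N $$ (c, j))"
    define L where "L =
      (\<lambda>i. mat (Suc s) n (\<lambda>(b, c). if b < s then U\<^sup>T $$ (b, c) else 1 / t i * ?P $$ (a, c)))"
    define M where "M = (\<lambda>i. L i * Y i * R')"
    define T where "T =
      mat (Suc s) (Suc s) (\<lambda>(b, b').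
      if b < s then (U\<^sup>T * ?X * R') $$ (b, b') else (?P * V * R') $$ (a, b'))"
    have R': "R' \<in> carrier_mat m (Suc s)" and L: "L i \<in> carrier_mat (Suc s) n" for i
      by (auto simp: R'_def L_def)
    have M: "M i \<in> carrier_mat (Suc s) (Suc s)" for i unfolding M_def using L R' Y
      by (intro mult_carrier_mat[of _ _ m] mult_carrier_mat[of _ _ n])
    have detM: "det (M i) = 0" for i
      unfolding M_def by (rule det_mult_low_rank_zero[OF L Y(1) R']) (use Y(2)[of i] in simp)
    have entry: "M i $$ (b, b') = (if b < s then (U\<^sup>T * Y i * R') $$ (b, b')
        else (?P * ((1 / t i) \<cdot>\<^sub>m (Y i - ?X)) * R') $$
          (a, b'))" if b: "b < Suc s" "b' < Suc s" for i b b'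
    proof -
      have YR: "Y i * R' \<in> carrier_mat n (Suc s)" by (rule mult_carrier_mat[OF Y(1) R'])
      have "M i $$ (b, b') = (\<Sum>c<n. L i $$ (b, c) * (Y i * R') $$ (c, b'))"
        unfolding M_def assoc_mult_mat[OF L Y(1) R']
        by (rule mult_mat_entry[OF L YR b])
      also have "\<dots> =
        (if b < s then (U\<^sup>T * (Y i * R')) $$ (b, b') else 1 / t i * (?P * (Y i * R')) $$ (a, b'))"
        unfolding mult_mat_entry[OF P YR a b(2)]
        using b mult_mat_entry[OF transpose_carrier_mat[THEN iffD2, OF Uc] YR _ b(2), of b]
        by (simp add: L_def sum_distrib_left mult.assoc del: index_mult_mat index_transpose_mat)
      also have "U\<^sup>T * (Y i * R') = U\<^sup>T * Y i * R'"
        by (rule assoc_mult_mat[OF transpose_carrier_mat[THEN iffD2, OF Uc] Y(1) R', symmetric])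
      \<comment> \<open>Subtracting the limit \<open>?X\<close> is free in the last row, as \<open>?P * ?X = 0\<close>.\<close>
      also have "1 / t i * (?P * (Y i * R')) $$ (a, b') =
        (?P * ((1 / t i) \<cdot>\<^sub>m (Y i - ?X)) * R') $$ (a, b')"
      proof -
        have "?P * ((1 / t i) \<cdot>\<^sub>m (Y i - ?X)) = (1 / t i) \<cdot>\<^sub>m (?P * Y i)"
          unfolding mult_smult_distrib[OF P minus_carrier_mat[OF X]] mult_minus_distrib_mat[OF P
            Y(1) X] PX
          using carrier_matD[OF mult_carrier_mat[OF P Y(1)[of i]]]
            by (intro eq_matI) (simp_all del: index_mult_mat)
        then have "?P * ((1 / t i) \<cdot>\<^sub>m (Y i - ?X)) * R' = (1 / t i) \<cdot>\<^sub>m (?P * (Y i * R'))"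
          using P Y(1)[of i] R'
            by (simp add: mult_smult_assoc_mat[of _ n m] assoc_mult_mat[of _ n n])
        moreover have "?P * (Y i * R') \<in> carrier_mat n (Suc s)" using P YR by simp
        ultimately show ?thesis using a b carrier_matD[of "?P * (Y i * R')"]
          by (simp del: index_mult_mat)
      qed
      finally show ?thesis .
    qed
    have "(\<lambda>i. det (M i)) \<longlonglongrightarrow> det T"
    proof (rule tendsto_det[OF M])
      show "T \<in> carrier_mat (Suc s) (Suc s)" by (simp add: T_def)
      fix b b' assume b: "b < Suc s" "b' < Suc s"
      show "(\<lambda>i. M i $$ (b, b')) \<longlonglongrightarrow> T $$ (b, b')"
      proof (cases "b < s")
        case True
        then show ?thesis
          using b by (simp add: entry T_def) (rule tendsto_mult_mat[OF _ Y(1) X R' lim], use Uc in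
            auto)
      next
        case False
        have "(\<lambda>i. (?P * ((1 / t i) \<cdot>\<^sub>m (Y i - ?X)) * R') $$ (a, b')) \<longlonglongrightarrow> (?P * V * R') $$ (a, b')"
        proof (rule tendsto_mult_mat[OF P _ V R' _ a b(2)])
          show "(1 / t i) \<cdot>\<^sub>m (Y i - ?X) \<in> carrier_mat n m" for i
            using minus_carrier_mat[OF X, of "Y i"] by simp
          show "(\<lambda>i. ((1 / t i) \<cdot>\<^sub>m (Y i - ?X)) $$ (a, c)) \<longlonglongrightarrow> V $$ (a, c)" if "a < n" "c < m" for a c
            using limV[OF that] carrier_matD[OF X] carrier_matD[OF Y(1)] that
            by (simp del: index_mult_mat)
        qed
        then show ?thesis using False b by (simp add: entry T_def)
      qed
    qed
    then have "det T = 0" using detM by (simp add: LIMSEQ_const_iff)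
    moreover have "det T = (?P * V * N) $$ (a, j)"
    proof -
      have HR: "(H * R') $$ (b, b') = (if b' < s then 1\<^sub>m s $$ (b, b') else 0)"
        if "b < s" "b' < Suc s" for b b'
      proof -
        have "(H * R') $$ (b, b') = (if b' < s then (H * R) $$ (b, b') else (H * N) $$ (b, j))"
          using that j R(1) H N by (simp add: R'_def scalar_prod_def)
        then show ?thesis using that j by (simp add: R(2) HN)
      qed
      have T: "T $$ (b, b') = (if b = b' then 1 else 0)" if "b < s" "b' < Suc s" for b b'
        using that HR[OF that] by (auto simp: T_def UX)
      have "det T = prod_list (diag_mat T)"
        by (rule det_lower_triangular[of "Suc s"]) (auto simp: T, auto simp: T_def)
      also have "\<dots> = T $$ (s, s)"
      proof -
        have "map (\<lambda>i. T $$ (i, i)) [0..<s] = map (\<lambda>i. 1) [0..<s]" using T by auto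
        moreover have "dim_row T = Suc s" by (simp add: T_def)
        ultimately show ?thesis
          by (simp add: diag_mat_def map_replicate_const prod_list_replicate del: map_eq_conv)
      qed
      also have "\<dots> = (?P * V * R') $$ (a, s)" by (simp add: T_def)
      also have "\<dots> = (?P * V * N) $$ (a, j)"
        unfolding mult_mat_entry[OF PV R' a lessI] mult_mat_entry[OF PV N a j] by (simp add: R'_def)
      finally show ?thesis .
    qed
    ultimately show ?thesis by simp
  qed
  have "?P * V * N = 0\<^sub>m n m"
    by (rule eq_matI) (use zero PV N in auto)
  moreover have "?P * V * N = ?P * V - ?P * V * (R * H)"
    unfolding N_def mult_minus_distrib_mat[OF PV one_carrier_mat mult_carrier_mat[OF R(1) H]]
    by (simp only: right_mult_one_mat[OF PV])
  ultimately have eq: "?P * V - ?P * V * (R * H) = 0\<^sub>m n m" by simp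
  have Z: "?P * V * (R * H) \<in> carrier_mat n m" using PV R H by simp
  have "?P * V = ?P * V * (R * H)"
  proof (rule eq_matI)
    fix a c assume "a < dim_row (?P * V * (R * H))" "c < dim_col (?P * V * (R * H))"
    then have ac: "a < n" "c < m" using Z by auto
    then have "(?P * V - ?P * V * (R * H)) $$ (a, c) = 0" unfolding eq by simp
    then show "(?P * V) $$ (a, c) = (?P * V * (R * H)) $$ (a, c)"
      using ac carrier_matD[OF PV] carrier_matD[OF Z] by (simp del: index_mult_mat)
  qed (use H V in auto)
  then show ?thesis by (simp only: assoc_mult_mat[OF PV R(1) H])
qed


section \<open>Unfoldings\<close>

text \<open>Column numbers determine the other indices, and both sides have the same number of
  elements.\<close>

lemma bij_betw_unfolding_index:
  assumes "k < d"
  shows "bij_betw (\<lambda>i. (i k, unfold_col d n k i)) (multi_indices d n)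
    ({..<n k} \<times> {..<\<Prod>l\<in>{..<d} - {k}. n l})"
proof -
  let ?f = "\<lambda>i. (i k, unfold_col d n k i)"
  have inj: "inj_on ?f (multi_indices d n)"
  proof (rule inj_onI)
    fix i j assume i: "i \<in> multi_indices d n" and j: "j \<in> multi_indices d n" and eq: "?f i = ?f j"
    have "i l = j l" if "l < d" for l
      using unfold_col_inj[of d i n j k l] multi_indices_less[OF i] multi_indices_less[OF j] eq that
      by (cases "l = k") auto
    then show "i = j" using i j unfolding multi_indices_def by (intro PiE_ext[of i _ _ j]) auto
  qed
  have sub: "?f ` multi_indices d n \<subseteq> {..<n k} \<times> {..<\<Prod>l\<in>{..<d} - {k}. n l}"
    using assms by (auto simp: multi_indices_less unfolding_mat_entry(1))
  have "card (multi_indices d n) = (\<Prod>l<d. n l)"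
    by (simp add: multi_indices_def card_PiE)
  also have "\<dots> = card ({..<n k} \<times> {..<\<Prod>l\<in>{..<d} - {k}. n l})"
    using assms by (simp add: card_cartesian_product prod.remove[of _ k])
  finally have "?f ` multi_indices d n = {..<n k} \<times> {..<\<Prod>l\<in>{..<d} - {k}. n l}"
    using inj sub by (intro card_subset_eq) (auto simp: card_image)
  then show ?thesis using inj by (simp add: bij_betw_def)
qed

lemma unfolding_mat_carrier [simp]:
  "unfolding_mat d n k X \<in> carrier_mat (n k) (\<Prod>l\<in>{..<d} - {k}. n l)"
  by (simp add: unfolding_mat_def)

lemma dim_unfolding_mat [simp]:
  "dim_row (unfolding_mat d n k X) = n k"
  "dim_col (unfolding_mat d n k X) = (\<Prod>l\<in>{..<d} - {k}. n l)"
  by (simp_all add: unfolding_mat_def)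

lemma unfolding_index_cases:
  assumes "k < d" "a < n k" "c < (\<Prod>l\<in>{..<d} - {k}. n l)"
  obtains i where "i \<in> multi_indices d n" "i k = a" "unfold_col d n k i = c"
proof -
  have "(a, c) \<in> (\<lambda>i. (i k, unfold_col d n k i)) ` multi_indices d n"
    using bij_betw_unfolding_index[OF assms(1), of n] assms by (simp add: bij_betw_def)
  then show ?thesis using that by auto
qed

lemma unfolding_mat_eqI:
  assumes "k < d" "A \<in> carrier_mat (n k) (\<Prod>l\<in>{..<d} - {k}. n l)"
    "\<And>i. i \<in> multi_indices d n \<Longrightarrow> A $$ (i k, unfold_col d n k i) = X i"
  shows "unfolding_mat d n k X = A"
proof (rule eq_matI)
  fix a c assume "a < dim_row A" "c < dim_col A"
  with assms(2) obtain i where "i \<in> multi_indices d n" "i k = a" "unfold_col d n k i = c"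
    using unfolding_index_cases[OF assms(1), of a n c] by auto
  then show "unfolding_mat d n k X $$ (a, c) = A $$ (a, c)"
    using unfolding_mat_entry(2)[of i d n k X] assms by auto
qed (use assms in \<open>auto simp: unfolding_mat_def\<close>)

lemma unfolding_mat_inj:
  assumes "k < d" "X \<in> tensors d n" "Y \<in> tensors d n" "unfolding_mat d n k X =
    unfolding_mat d n k Y"
  shows "X = Y"
proof
  fix i show "X i = Y i"
    using assms unfolding_mat_entry(2)[of i d n k X] unfolding_mat_entry(2)[of i d n k Y]
    by (cases "i \<in> multi_indices d n") (auto simp: tensors_def)
qed

lemma unfolding_mat_cong:
  assumes "\<And>l. l < d \<Longrightarrow> n l = m l" "k < d"
  shows "unfolding_mat d n k X = unfolding_mat d m k X"
  by (rule unfolding_mat_eqI)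
    (use assms unfolding_mat_entry(2)[of _ d m k X] multi_indices_cong[of d n m]
      unfold_col_cong[of d k _ _ n m] unfolding_mat_carrier[of d m k X] in auto)

lemma unfolding_mat_add:
  "k < d \<Longrightarrow> unfolding_mat d n k (X + Y) = unfolding_mat d n k X + unfolding_mat d n k Y"
  by (rule eq_matI) (simp_all add: unfolding_mat_def)

lemma unfolding_mat_scale:
  "k < d \<Longrightarrow> unfolding_mat d n k (tensor_scale c X) = c \<cdot>\<^sub>m unfolding_mat d n k X"
  by (rule eq_matI) (simp_all add: unfolding_mat_def tensor_scale_def)

lemma tensor_inner_unfolding:
  assumes "k < d"
  shows "tensor_inner d n X Y = (\<Sum>a<n k. \<Sum>c<(\<Prod>l\<in>{..<d} - {k}. n l).
    unfolding_mat d n k X $$ (a, c) * unfolding_mat d n k Y $$ (a, c))"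
proof -
  have "(\<Sum>a<n k. \<Sum>c<(\<Prod>l\<in>{..<d} - {k}. n l). unfolding_mat d n k X $$ (a, c) *
    unfolding_mat d n k Y $$ (a, c)) =
    (\<Sum>(a, c)\<in>{..<n k} \<times> {..<(\<Prod>l\<in>{..<d} - {k}. n l)}. unfolding_mat d n k X $$
      (a, c) * unfolding_mat d n k Y $$ (a, c))"
    by (simp add: sum.cartesian_product)
  also have "\<dots> =
    (\<Sum>i\<in>multi_indices d n. unfolding_mat d n k X $$ (i k, unfold_col d n k i) * unfolding_mat d n
    k Y $$ (i k, unfold_col d n k i))"
    using sum.reindex_bij_betw[OF bij_betw_unfolding_index[OF assms, of n],
        of "\<lambda>(a, c). unfolding_mat d n k X $$ (a, c) * unfolding_mat d n k Y $$ (a, c)"] by simp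
  also have "\<dots> = tensor_inner d n X Y"
    using assms by (simp add: tensor_inner_def unfolding_mat_entry)
  finally show ?thesis by simp
qed

lemma kron_except_Suc:
  "kron_except (Suc d) A k = (if d = k then kron_except d A k else kron (A d) (kron_except d A k))"
  by (simp add: kron_except_def)

lemma kron_except_cong:
  "(\<And>l. l < d \<Longrightarrow> l \<noteq> k \<Longrightarrow> A l = B l) \<Longrightarrow> kron_except d A k = kron_except d B k"
  unfolding kron_except_def by (auto intro!: arg_cong2[where f = "\<lambda>xs. foldr kron xs"])

lemma kron_except_carrier:
  assumes "\<And>l. l < d \<Longrightarrow> l \<noteq> k \<Longrightarrow> A l \<in> carrier_mat (n l) (m l)"
  shows "kron_except d A k \<in> carrier_mat (\<Prod>l\<in>{..<d} - {k}. n l) (\<Prod>l\<in>{..<d} - {k}. m l)"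
  using assms
proof (induction d)
  case 0
  then show ?case by (simp add: kron_except_def)
next
  case (Suc d)
  then have IH: "kron_except d A k \<in> carrier_mat (\<Prod>l\<in>{..<d} - {k}. n l) (\<Prod>l\<in>{..<d} - {k}. m l)"
    by auto
  show ?case
    unfolding kron_except_Suc prod_except_Suc
    using IH Suc.prems[of d] by (auto simp: kron_def)
qed

text \<open>Column numbers are mixed-radix numbers with the highest mode as their leading digit,
  so \<open>div\<close> and \<open>mod\<close> in the Kronecker product split off the entry of the last factor.\<close>

lemma kron_except_entry:
  assumes "\<And>l. l < d \<Longrightarrow> l \<noteq> k \<Longrightarrow> A l \<in> carrier_mat (n l) (m l)"
    and "\<forall>l<d. i l < n l" "\<forall>l<d. j l < m l"
  shows "kron_except d A k $$ (unfold_col d n k i, unfold_col d m k j) =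
    (\<Prod>l\<in>{..<d} - {k}. A l $$ (i l, j l))"
  using assms
proof (induction d)
  case 0
  then show ?case by (simp add: kron_except_def unfold_col_def)
next
  case (Suc d)
  have IH: "kron_except d A k $$ (unfold_col d n k i, unfold_col d m k j) =
    (\<Prod>l\<in>{..<d} - {k}. A l $$ (i l, j l))" using Suc by auto
  have K: "kron_except d A k \<in> carrier_mat (\<Prod>l\<in>{..<d} - {k}. n l) (\<Prod>l\<in>{..<d} - {k}. m l)"
    by (rule kron_except_carrier) (use Suc in auto)
  have lt: "unfold_col d n k i < (\<Prod>l\<in>{..<d} - {k}. n l)" "unfold_col d m k j < (\<Prod>l\<in>{..<d} - {k}.
    m l)"
    using Suc.prems by (auto intro!: unfold_col_less)
  show ?case
  proof (cases "d = k")
    case True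
    then show ?thesis using IH
      by (simp add: kron_except_Suc unfold_col_Suc lessThan_Suc insert_Diff_if)
  next
    case False
    have "unfold_col (Suc d) n k i < (\<Prod>l\<in>{..<Suc d} - {k}. n l)"
      "unfold_col (Suc d) m k j < (\<Prod>l\<in>{..<Suc d} - {k}. m l)"
      using Suc.prems by (auto intro!: unfold_col_less)
    then have b: "i d * (\<Prod>l\<in>{..<d} - {k}. n l) + unfold_col d n k i < n d * (\<Prod>l\<in>{..<d} - {k}. n l)"
      "j d * (\<Prod>l\<in>{..<d} - {k}. m l) + unfold_col d m k j < m d * (\<Prod>l\<in>{..<d} - {k}. m l)"
      using False unfolding unfold_col_Suc prod_except_Suc by simp_all
    have "A d \<in> carrier_mat (n d) (m d)" using Suc.prems(1)[of d] False by auto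
    moreover have "(a * p + b) div p = a" if "b < p" for a b p :: nat
      using that by simp
    note this[OF lt(1), of "i d"] this[OF lt(2), of "j d"]
    ultimately have "kron_except (Suc d) A k $$ (unfold_col (Suc d) n k i, unfold_col (Suc d) m k
      j) =
        A d $$ (i d, j d) * kron_except d A k $$ (unfold_col d n k i, unfold_col d m k j)"
      using False K b lt by (simp add: kron_def kron_except_Suc unfold_col_Suc)
    then show ?thesis using False IH by (simp add: lessThan_Suc insert_Diff_if)
  qed
qed

lemma kron_except_transpose:
  "(kron_except d A k)\<^sup>T = kron_except d (\<lambda>l. (A l)\<^sup>T) k"
proof (induction d)
  case 0
  then show ?case by (simp add: kron_except_def)
next
  case (Suc d)
  have "(kron P Q)\<^sup>T = kron (P\<^sup>T) (Q\<^sup>T)" for P Q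
  proof (rule eq_matI)
    fix a b assume "a < dim_row (kron (P\<^sup>T) (Q\<^sup>T))" "b < dim_col (kron (P\<^sup>T) (Q\<^sup>T))"
    then have ab: "a < dim_col P * dim_col Q" "b < dim_row P * dim_row Q" by (auto simp: kron_def)
    then have "0 < dim_col Q" "0 < dim_row Q" by (auto intro!: Nat.gr0I)
    then show "(kron P Q)\<^sup>T $$ (a, b) = kron (P\<^sup>T) (Q\<^sup>T) $$ (a, b)"
      using ab by (simp add: kron_def less_mult_imp_div_less)
  qed (auto simp: kron_def)
  then show ?case using Suc by (cases "d = k") (simp_all add: kron_except_Suc)
qed

text \<open>The sum over multi-indices splits into one over the mode-\<open>k\<close> index, which is a
  multiplication by \<open>A k\<close> from the left, and one over the column numbers, on which the other
  factors act as a Kronecker product.\<close>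

lemma unfolding_mode_map:
  assumes A: "\<And>l. l < d \<Longrightarrow> A l \<in> carrier_mat (n l) (m l)" and k: "k < d"
  shows "unfolding_mat d n k (mode_map d n m A X) =
    A k * unfolding_mat d m k X * (kron_except d A k)\<^sup>T"
proof (rule unfolding_mat_eqI[OF k])
  let ?P = "\<Prod>l\<in>{..<d} - {k}. m l"
  have K: "kron_except d A k \<in> carrier_mat (\<Prod>l\<in>{..<d} - {k}. n l) ?P"
    by (rule kron_except_carrier) (use A in auto)
  show "A k * unfolding_mat d m k X * (kron_except d A k)\<^sup>T \<in> carrier_mat (n k) (\<Prod>l\<in>{..<d} - {k}.
    n l)"
    using A[OF k] K by auto
  fix i assume i: "i \<in> multi_indices d n"
  have lt: "i k < n k" "unfold_col d n k i < (\<Prod>l\<in>{..<d} - {k}. n l)"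
    using i k by (auto simp: multi_indices_less unfolding_mat_entry)
  have M: "unfolding_mat d m k X \<in> carrier_mat (m k) ?P" by simp
  have "(A k * unfolding_mat d m k X * (kron_except d A k)\<^sup>T) $$ (i k, unfold_col d n k i) =
      (\<Sum>c<?P. (\<Sum>b<m k. A k $$ (i k, b) * unfolding_mat d m k X $$ (b, c)) * kron_except d A k $$
        (unfold_col d n k i, c))"
    using A[OF k] K M lt by (simp add: scalar_prod_def atLeast0LessThan)
  also have "\<dots> =
    (\<Sum>c<?P. \<Sum>b<m k. A k $$ (i k, b) * unfolding_mat d m k X $$ (b, c) * kron_except d A k $$
    (unfold_col d n k i, c))"
    by (simp add: sum_distrib_right)
  also have "\<dots> =
    (\<Sum>(b, c)\<in>{..<m k} \<times> {..<?P}. A k $$ (i k, b) * unfolding_mat d m k X $$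
    (b, c) * kron_except d A k $$ (unfold_col d n k i, c))"
    by (subst sum.swap) (simp add: sum.cartesian_product)
  also have "\<dots> =
    (\<Sum>j\<in>multi_indices d m. A k $$ (i k, j k) * unfolding_mat d m k X $$ (j k, unfold_col d m k j) *
      kron_except d A k $$ (unfold_col d n k i, unfold_col d m k j))"
    using sum.reindex_bij_betw[OF bij_betw_unfolding_index[OF k, of m],
        of "\<lambda>(b, c). A k $$ (i k, b) * unfolding_mat d m k X $$ (b, c) *
          kron_except d A k $$ (unfold_col d n k i, c)"] by simp
  also have "\<dots> = (\<Sum>j\<in>multi_indices d m. (\<Prod>l<d. A l $$ (i l, j l)) * X j)"
  proof (intro sum.cong refl)
    fix j assume j: "j \<in> multi_indices d m"
    have "kron_except d A k $$ (unfold_col d n k i, unfold_col d m k j) =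
      (\<Prod>l\<in>{..<d} - {k}. A l $$ (i l, j l))"
      by (rule kron_except_entry) (use A i j in \<open>auto simp: multi_indices_less\<close>)
    then show "A k $$ (i k, j k) * unfolding_mat d m k X $$ (j k, unfold_col d m k j) *
      kron_except d A k $$ (unfold_col d n k i, unfold_col d m k j) = (\<Prod>l<d. A l $$
        (i l, j l)) * X j"
      using k j by (simp add: unfolding_mat_entry prod.remove[of _ k])
  qed
  finally show "(A k * unfolding_mat d m k X *
    (kron_except d A k)\<^sup>T) $$ (i k, unfold_col d n k i) = mode_map d n m A X i"
    using i by (simp add: mode_map_def)
qed

text \<open>The Kronecker product of identities acts trivially. This is read off from the general
  formula for the identity transformation, which avoids computing that Kronecker product.\<close>

lemma unfolding_mode_map_single:
  assumes k: "k < d" and A: "A \<in> carrier_mat p (m k)" and X: "X \<in> tensors d m"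
  shows "unfolding_mat d (m(k := p)) k (mode_map d (m(k := p)) m ((\<lambda>l. 1\<^sub>m (m l))(k := A)) X) =
    A * unfolding_mat d m k X"
proof -
  let ?K = "kron_except d (\<lambda>l. 1\<^sub>m (m l)) k"
  have K: "?K\<^sup>T \<in> carrier_mat (\<Prod>l\<in>{..<d} - {k}. m l) (\<Prod>l\<in>{..<d} - {k}. m l)"
    using kron_except_carrier[of d k "\<lambda>l. 1\<^sub>m (m l)" m m] by simp
  have "unfolding_mat d m k X = 1\<^sub>m (m k) * unfolding_mat d m k X * ?K\<^sup>T"
    using unfolding_mode_map[of d "\<lambda>l. 1\<^sub>m (m l)" m m k X] k mode_map_one[OF X] by simp
  then have "unfolding_mat d m k X * ?K\<^sup>T = unfolding_mat d m k X"
    using left_mult_one_mat[OF unfolding_mat_carrier[of d m k X]] by simp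
  moreover have "unfolding_mat d (m(k := p)) k (mode_map d (m(k := p)) m ((\<lambda>l.
    1\<^sub>m (m l))(k := A)) X) =
      A * unfolding_mat d m k X * ?K\<^sup>T"
    using unfolding_mode_map[of d "(\<lambda>l. 1\<^sub>m (m l))(k := A)" "m(k := p)" m k X] k A
      kron_except_cong[of d k "(\<lambda>l. 1\<^sub>m (m l))(k := A)" "\<lambda>l. 1\<^sub>m (m l)"] by simp
  ultimately show ?thesis
    using assoc_mult_mat[OF A unfolding_mat_carrier K] by simp
qed

text \<open>The trace pairing of matrices carried over to tensors: it reduces the matrix
  equations of the proposition to orthogonality relations.\<close>

lemma unfolding_mult_transpose_zero_iff:
  assumes k: "k < d" and G: "G \<in> tensors d s"
  shows "unfolding_mat d (s(k := p)) k Z * (unfolding_mat d s k G)\<^sup>T = 0\<^sub>m p (s k) \<longleftrightarrow>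
    (\<forall>F\<in>carrier_mat p (s k).
      tensor_inner d (s(k := p)) Z (mode_map d (s(k := p)) s ((\<lambda>l. 1\<^sub>m (s l))(k := F)) G) = 0)"
proof -
  let ?P = "\<Prod>l\<in>{..<d} - {k}. s l"
  have P: "(\<Prod>l\<in>{..<d} - {k}. (s(k := p)) l) = ?P" by (intro prod.cong) auto
  have Z: "unfolding_mat d (s(k := p)) k Z \<in> carrier_mat p ?P"
    using unfolding_mat_carrier[of d "s(k := p)" k Z] by (simp add: P del: unfolding_mat_carrier)
  have "tensor_inner d (s(k := p)) Z (mode_map d (s(k := p)) s ((\<lambda>l. 1\<^sub>m (s l))(k := F)) G) =
      (\<Sum>a<p. \<Sum>c<?P. unfolding_mat d (s(k := p)) k Z $$ (a, c) * (F * unfolding_mat d s k G) $$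
        (a, c))"
    if "F \<in> carrier_mat p (s k)" for F
    unfolding tensor_inner_unfolding[OF k] unfolding_mode_map_single[OF k that G] P by simp
  then show ?thesis
    unfolding mult_transpose_zero_iff[OF Z unfolding_mat_carrier] by simp
qed


section \<open>Tucker ranks\<close>

lemma tucker_rank_mode_map_le:
  assumes A: "\<And>l. l < d \<Longrightarrow> A l \<in> carrier_mat (n l) (m l)" and k: "k < d"
  shows "tucker_rank d n (mode_map d n m A X) k \<le> m k"
proof -
  let ?B = "unfolding_mat d m k X * (kron_except d A k)\<^sup>T"
  have K: "(kron_except d A k)\<^sup>T \<in> carrier_mat (\<Prod>l\<in>{..<d} - {k}. m l) (\<Prod>l\<in>{..<d} - {k}. n l)"
    using kron_except_carrier[of d k A n m] A by simp
  have "unfolding_mat d n k (mode_map d n m A X) = A k * ?B"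
    by (subst unfolding_mode_map[of d A n m k X, OF A k])
      (assumption, rule assoc_mult_mat[OF A[OF k] unfolding_mat_carrier K])
  moreover have "?B \<in> carrier_mat (m k) (\<Prod>l\<in>{..<d} - {k}. n l)" using K
    by (rule mult_carrier_mat[OF unfolding_mat_carrier])
  ultimately have "tucker_rank d n (mode_map d n m A X) k \<le> vec_space.rank (n k) (A k)"
    unfolding tucker_rank_def using rank_mult_le_left[OF A[OF k]] by simp
  also have "\<dots> \<le> m k" by (rule vec_space.rank_le_nc[OF A[OF k]])
  finally show ?thesis .
qed

lemma tucker_rank_add_le:
  assumes "k < d"
  shows "tucker_rank d n (X + Y) k \<le> tucker_rank d n X k + tucker_rank d n Y k"
  unfolding tucker_rank_def unfolding_mat_add[OF assms]
  by (rule vec_space.rank_subadditive[OF unfolding_mat_carrier unfolding_mat_carrier])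

lemma tucker_rank_scale_le:
  assumes "k < d"
  shows "tucker_rank d n (tensor_scale c X) k \<le> tucker_rank d n X k"
proof -
  let ?X = "unfolding_mat d n k X" and ?P = "\<Prod>l\<in>{..<d} - {k}. n l"
  have "c \<cdot>\<^sub>m ?X = ?X * (c \<cdot>\<^sub>m 1\<^sub>m ?P)"
    unfolding mult_smult_distrib[OF unfolding_mat_carrier one_carrier_mat] right_mult_one_mat[OF
      unfolding_mat_carrier] ..
  then show ?thesis
    unfolding tucker_rank_def unfolding_mat_scale[OF assms]
    using rank_mult_le_left[OF unfolding_mat_carrier[of d n k X] smult_carrier_mat[OF
      one_carrier_mat, where k = c]]
    by metis
qed

lemma tucker_rank_elementary_le: "k < d \<Longrightarrow> tucker_rank d n (elementary_tensor d n v) k \<le> 1"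
  unfolding elementary_tensor_eq_mode_map by (rule tucker_rank_mode_map_le) auto

text \<open>Stated for a factor \<open>v k\<close> in the span of \<open>U\<close>, to see that adding the elementary
  tensor does not enlarge a mode-\<open>k\<close> column space contained in that span.\<close>

lemma unfolding_elementary_factor:
  assumes k: "k < d" and v: "v k \<in> mat_span U" and U: "U \<in> carrier_mat (n k) p"
  obtains M where "M \<in> carrier_mat p (\<Prod>l\<in>{..<d} - {k}. n l)"
    "unfolding_mat d n k (elementary_tensor d n v) = U * M"
proof -
  let ?A = "\<lambda>k. mat (n k) 1 (\<lambda>(a, b :: nat). v k $ a)"
  let ?B = "unfolding_mat d (\<lambda>k. 1) k (\<lambda>i. 1) * (kron_except d ?A k)\<^sup>T"
  obtain x where x: "x \<in> carrier_vec p" "v k = U *\<^sub>v x" using v unfolding mat_span_eq[OF U] by auto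
  define C where "C = mat p 1 (\<lambda>(a, b :: nat). x $ a)"
  have C: "C \<in> carrier_mat p 1" by (simp add: C_def)
  have K: "(kron_except d ?A k)\<^sup>T \<in> carrier_mat (\<Prod>l\<in>{..<d} - {k}. 1) (\<Prod>l\<in>{..<d} - {k}. n l)"
    using kron_except_carrier[of d k ?A n "\<lambda>l. 1"] by simp
  have B: "?B \<in> carrier_mat 1 (\<Prod>l\<in>{..<d} - {k}. n l)"
    using mult_carrier_mat[OF unfolding_mat_carrier K] by simp
  have "?A k = U * C"
  proof (rule eq_matI)
    fix a b assume "a < dim_row (U * C)" "b < dim_col (U * C)"
    then have ab: "a < n k" "b < 1" using U C by auto
    show "?A k $$ (a, b) = (U * C) $$ (a, b)"
      unfolding mult_mat_entry[OF U C ab]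
      using ab x(1) U by (simp add: x(2) C_def scalar_prod_def atLeast0LessThan)
  qed (use U C in auto)
  moreover have "unfolding_mat d n k (elementary_tensor d n v) = ?A k * ?B"
    unfolding elementary_tensor_eq_mode_map
  proof (subst unfolding_mode_map[of d ?A n "\<lambda>k. 1" k, OF _ k])
    show "?A k * unfolding_mat d (\<lambda>k. 1) k (\<lambda>i. 1) * (kron_except d ?A k)\<^sup>T = ?A k * ?B"
      by (rule assoc_mult_mat[OF _ unfolding_mat_carrier K]) auto
  qed auto
  ultimately have "unfolding_mat d n k (elementary_tensor d n v) = U * (C * ?B)"
    using assoc_mult_mat[OF U C B] by simp
  then show ?thesis using that mult_carrier_mat[OF C B] by blast
qed


section \<open>Tangent lines\<close>

lemma tendsto_fun_iff: "(f \<longlongrightarrow> l) F \<longleftrightarrow> (\<forall>i. ((\<lambda>x. f x i) \<longlongrightarrow> l i) F)"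
  using limitin_componentwise[of "\<lambda>i. euclidean" UNIV f l F]
  by (simp add: euclidean_product_topology)

lemma tangent_cone_of_line:
  assumes "\<And>\<tau>. X + tensor_scale \<tau> V \<in> C"
  shows "V \<in> tangent_cone C X"
proof -
  define t where "t = (\<lambda>j. inverse (real (Suc j)))"
  define Y where "Y = (\<lambda>j. X + tensor_scale (t j) V)"
  have t: "t j > 0" for j by (simp add: t_def)
  have lim: "t \<longlonglongrightarrow> 0" unfolding t_def by (rule LIMSEQ_inverse_real_of_nat)
  have "(\<lambda>j. X i + t j * V i) \<longlonglongrightarrow> X i + 0 * V i" for i
    by (intro tendsto_intros lim)
  then have "Y \<longlonglongrightarrow> X" unfolding tendsto_fun_iff by (simp add: Y_def tensor_scale_def)
  moreover have "tensor_scale (1 / t j) (Y j - X) = V" for j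
    using t[of j] by (auto simp: Y_def tensor_scale_def fun_eq_iff)
  ultimately show ?thesis
    unfolding tangent_cone_def using t lim assms
    by (intro CollectI exI[of _ t] exI[of _ Y]) (auto simp: Y_def)
qed

text \<open>The line passes through \<open>X\<close> in both directions, so the inequality for normal vectors
  holds for \<open>V\<close> and \<open>- V\<close>.\<close>

lemma normal_cone_orth_line:
  assumes W: "W \<in> normal_cone d n C X" and line: "\<And>\<tau>. X + tensor_scale \<tau> V \<in> C"
  shows "tensor_inner d n W V = 0"
proof -
  have "X + tensor_scale \<tau> (tensor_scale (- 1) V) \<in> C" for \<tau>
    using line[of "- \<tau>"] by (simp add: tensor_scale_def)
  then have "V \<in> tangent_cone C X" "tensor_scale (- 1) V \<in> tangent_cone C X"
    using line by (auto intro: tangent_cone_of_line)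
  then have "tensor_inner d n W V \<le> 0" "tensor_inner d n W (tensor_scale (- 1) V) \<le> 0"
    using W by (auto simp: normal_cone_def)
  then show ?thesis unfolding tensor_inner_scale_right by linarith
qed

section \<open>The normal cone at a Tucker decomposition\<close>

locale tucker_point =
  fixes d :: nat and n r s :: "nat \<Rightarrow> nat" and X G :: tensor and U :: "nat \<Rightarrow> real mat"
  assumes X_variety: "X \<in> tucker_variety d n r" and decomp: "tucker_decomposition d n X s G U"
begin

definition saturated :: "nat set" where
  "saturated = {k. k < d \<and> s k = r k}"

text \<open>The factor \<open>S\<^sub>k\<close> of the proposition.\<close>

definition mode_space :: "nat \<Rightarrow> real vec set" where
  "mode_space k = (if s k < r k then carrier_vec (n k) else mat_span (U k))"

text \<open>Orthogonality to the two families of tangent directions that together determine the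
  normal cone.\<close>

definition normal_conditions :: "tensor \<Rightarrow> bool" where
  "normal_conditions W \<longleftrightarrow> W \<in> tensors d n \<and>
    (\<forall>v. (\<forall>k<d. v k \<in> mode_space k) \<longrightarrow> tensor_inner d n W (elementary_tensor d n v) = 0) \<and>
    (\<forall>k\<in>saturated. \<forall>F\<in>carrier_mat (n k) (s k). (U k)\<^sup>T * F = 0\<^sub>m (s k) (s k) \<longrightarrow>
      tensor_inner d n W (mode_map d n s (U(k := F)) G) = 0)"

lemma U_stiefel: "k < d \<Longrightarrow> U k \<in> stiefel (s k) (n k)"
  using decomp by (simp add: tucker_decomposition_def)

lemma U_carrier: "k < d \<Longrightarrow> U k \<in> carrier_mat (n k) (s k)"
  using U_stiefel stiefelD by blast

lemma UtU: "k < d \<Longrightarrow> (U k)\<^sup>T * U k = 1\<^sub>m (s k)"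
  using U_stiefel stiefelD by blast

lemma G_tensors: "G \<in> tensors d s"
  using decomp by (simp add: tucker_decomposition_def)

lemma rank_X: "k < d \<Longrightarrow> tucker_rank d n X k = s k"
  using decomp unfolding tucker_decomposition_def by blast

lemma s_le_r: "k < d \<Longrightarrow> s k \<le> r k"
  using X_variety rank_X by (auto simp: tucker_variety_def)

lemma X_eq: "X = mode_map d n s U G"
  using decomp mode_prods_eq_mode_map[of d U n s G] U_carrier G_tensors
  by (simp add: tucker_decomposition_def)

lemma X_tensors: "X \<in> tensors d n"
  using X_variety by (simp add: tucker_variety_def)

lemma U_upd_carrier:
  "F \<in> carrier_mat (n k) (s k) \<Longrightarrow> l < d \<Longrightarrow> (U(k := F)) l \<in> carrier_mat (n l) (s l)"
  using U_carrier by auto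

text \<open>The matrix \<open>H\<close> such that \<open>U k * H\<close> is the mode-\<open>k\<close> unfolding of \<open>X\<close>.\<close>

definition row_factor :: "nat \<Rightarrow> real mat" where
  "row_factor k = unfolding_mat d s k G * (kron_except d U k)\<^sup>T"

lemma kron_carrier: "(kron_except d U k)\<^sup>T \<in> carrier_mat (\<Prod>l\<in>{..<d} - {k}. s l) (\<Prod>l\<in>{..<d} - {k}.
  n l)"
  using kron_except_carrier[of d k U n s] U_carrier by simp

lemma row_factor_carrier: "row_factor k \<in> carrier_mat (s k) (\<Prod>l\<in>{..<d} - {k}. n l)"
  unfolding row_factor_def by (rule mult_carrier_mat[OF unfolding_mat_carrier kron_carrier])

lemma unfolding_replaced_factor:
  assumes k: "k < d" and F: "F \<in> carrier_mat (n k) (s k)"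
  shows "unfolding_mat d n k (mode_map d n s (U(k := F)) G) = F * row_factor k"
proof -
  have "unfolding_mat d n k (mode_map d n s (U(k := F)) G) =
      F * unfolding_mat d s k G * (kron_except d (U(k := F)) k)\<^sup>T"
    using unfolding_mode_map[of d "U(k := F)" n s k G, OF U_upd_carrier[OF F] k] by simp
  also have "kron_except d (U(k := F)) k = kron_except d U k" by (rule kron_except_cong) simp
  also have "F * unfolding_mat d s k G * (kron_except d U k)\<^sup>T = F * row_factor k"
    unfolding row_factor_def by (rule assoc_mult_mat[OF F unfolding_mat_carrier kron_carrier])
  finally show ?thesis .
qed

lemma unfolding_X: "k < d \<Longrightarrow> unfolding_mat d n k X = U k * row_factor k"
  using unfolding_replaced_factor[OF _ U_carrier, of k] by (simp add: X_eq)

lemma elementary_line_in_variety: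
  assumes v: "\<And>k. k < d \<Longrightarrow> v k \<in> mode_space k"
  shows "X + tensor_scale \<tau> (elementary_tensor d n v) \<in> tucker_variety d n r"
proof -
  let ?V = "elementary_tensor d n v"
  have "tucker_rank d n (X + tensor_scale \<tau> ?V) k \<le> r k" if k: "k < d" for k
  proof (cases "s k < r k")
    case True
    have "tucker_rank d n (X + tensor_scale \<tau> ?V) k \<le> tucker_rank d n X k +
      tucker_rank d n (tensor_scale \<tau> ?V) k"
      by (rule tucker_rank_add_le[OF k])
    also have "\<dots> \<le> s k + 1"
      using rank_X[OF k] tucker_rank_scale_le[OF k, of n \<tau> ?V] tucker_rank_elementary_le[OF k, of
        n v] by simp
    finally show ?thesis using True by simp
  next
    case False
    let ?H = "row_factor k"
    have "v k \<in> mat_span (U k)" using v[OF k] False by (simp add: mode_space_def)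
    then obtain M where M: "M \<in> carrier_mat (s k) (\<Prod>l\<in>{..<d} - {k}. n l)"
      "unfolding_mat d n k ?V = U k * M"
      using unfolding_elementary_factor[of k d v "U k" n "s k", OF k _ U_carrier[OF k]] by blast
    have "unfolding_mat d n k (X + tensor_scale \<tau> ?V) = U k * (?H + \<tau> \<cdot>\<^sub>m M)"
      unfolding unfolding_mat_add[OF k] unfolding_mat_scale[OF k] unfolding_X[OF k] M(2)
        mult_add_distrib_mat[OF U_carrier[OF k] row_factor_carrier smult_carrier_mat[OF M(1)]]
        mult_smult_distrib[OF U_carrier[OF k] M(1)] ..
    moreover have "?H + \<tau> \<cdot>\<^sub>m M \<in> carrier_mat (s k) (\<Prod>l\<in>{..<d} - {k}. n l)"
      using row_factor_carrier M(1) by simp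
    ultimately have "tucker_rank d n (X + tensor_scale \<tau> ?V) k \<le> vec_space.rank (n k) (U k)"
      using rank_mult_le_left[OF U_carrier[OF k]] by (simp add: tucker_rank_def)
    also have "\<dots> \<le> s k" by (rule vec_space.rank_le_nc[OF U_carrier[OF k]])
    finally show ?thesis using s_le_r[OF k] by simp
  qed
  then show ?thesis
    using X_tensors unfolding tucker_variety_def
    by (auto intro!: add_tensors simp del: plus_fun_apply)
qed

lemma factor_line_in_variety:
  assumes k: "k < d" and F: "F \<in> carrier_mat (n k) (s k)"
  shows "X + tensor_scale \<tau> (mode_map d n s (U(k := F)) G) \<in> tucker_variety d n r"
proof -
  have F': "U k + \<tau> \<cdot>\<^sub>m F \<in> carrier_mat (n k) (s k)" using F U_carrier[OF k] by simp
  have "X + tensor_scale \<tau> (mode_map d n s (U(k := F)) G) =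
    mode_map d n s (U(k := U k + \<tau> \<cdot>\<^sub>m F)) G"
    using mode_map_add_factor[of k d "U k" n s "\<tau> \<cdot>\<^sub>m F" U G, OF k U_carrier[OF k]
      smult_carrier_mat[OF F]]
      mode_map_smult_factor[of k d F n s U \<tau> G, OF k F] by (simp add: X_eq del: plus_fun_apply)
  moreover have "tucker_rank d n (mode_map d n s (U(k := U k + \<tau> \<cdot>\<^sub>m F)) G) l \<le> r l" if "l < d"
    for l
    using tucker_rank_mode_map_le[of d "U(k := U k + \<tau> \<cdot>\<^sub>m F)" n s l G, OF U_upd_carrier[OF F']
      that] s_le_r[OF that]
    by simp
  ultimately show ?thesis by (simp add: tucker_variety_def)
qed

lemma normal_cone_imp_conditions:
  assumes W: "W \<in> normal_cone d n (tucker_variety d n r) X"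
  shows "normal_conditions W"
  unfolding normal_conditions_def
proof (intro conjI allI impI ballI)
  show "W \<in> tensors d n" using W by (simp add: normal_cone_def)
next
  fix v assume "\<forall>k<d. v k \<in> mode_space k"
  then show "tensor_inner d n W (elementary_tensor d n v) = 0"
    using normal_cone_orth_line[OF W elementary_line_in_variety] by simp
next
  fix k and F :: "real mat" assume "k \<in> saturated" "F \<in> carrier_mat (n k) (s k)"
  then show "tensor_inner d n W (mode_map d n s (U(k := F)) G) = 0"
    using normal_cone_orth_line[OF W factor_line_in_variety] by (simp add: saturated_def)
qed

lemma tangent_vector_tensors:
  assumes "V \<in> tangent_cone (tucker_variety d n r) X"
  shows "V \<in> tensors d n"
proof -
  obtain t Y where Y: "\<And>j. Y j \<in> tucker_variety d n r"
    and lim: "(\<lambda>j::nat. tensor_scale (1 / t j) (Y j - X)) \<longlonglongrightarrow> V"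
    using assms by (auto simp: tangent_cone_def)
  have "V i = 0" if i: "i \<notin> multi_indices d n" for i
  proof -
    have "tensor_scale (1 / t j) (Y j - X) i = 0" for j
      using Y[of j] X_tensors i by (simp add: tucker_variety_def tensors_def tensor_scale_def)
    moreover have "(\<lambda>j. tensor_scale (1 / t j) (Y j - X) i) \<longlonglongrightarrow> V i"
      using lim unfolding tendsto_fun_iff by blast
    ultimately show ?thesis by (simp add: LIMSEQ_const_iff)
  qed
  then show ?thesis by (simp add: tensors_def)
qed

text \<open>In a saturated mode the points approaching \<open>X\<close> have unfoldings of rank at most \<open>s k\<close>,
  which is the rank at \<open>X\<close> itself. So the matrix lemma applies to the unfoldings and yields the
  factor \<open>F\<close>.\<close>

lemma tangent_vector_perp_part:
  assumes V: "V \<in> tangent_cone (tucker_variety d n r) X" and k: "k \<in> saturated"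
  obtains F where "F \<in> carrier_mat (n k) (s k)" "(U k)\<^sup>T * F = 0\<^sub>m (s k) (s k)"
    "mode_map d n n ((\<lambda>l. 1\<^sub>m (n l))(k := proj_perp (U k))) V = mode_map d n s (U(k := F)) G"
proof -
  have kd: "k < d" and sr: "s k = r k" using k by (auto simp: saturated_def)
  note Uc = U_carrier[OF kd] and P = proj_perp_props[OF U_stiefel[OF kd]]
  let ?P = "proj_perp (U k)" and ?V = "unfolding_mat d n k V" and ?p = "\<Prod>l\<in>{..<d} - {k}. n l"
  obtain t Y where t: "\<And>j::nat. t j > (0::real)" and Y: "\<And>j. Y j \<in> tucker_variety d n r"
    and lim: "Y \<longlonglongrightarrow> X" and limV: "(\<lambda>j. tensor_scale (1 / t j) (Y j - X)) \<longlonglongrightarrow> V"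
    using V by (auto simp: tangent_cone_def)
  have "vec_space.rank (n k) (U k * row_factor k) = s k"
    using rank_X[OF kd] unfolding_X[OF kd] by (simp add: tucker_rank_def)
  then obtain R where R: "R \<in> carrier_mat ?p (s k)" "row_factor k * R = 1\<^sub>m (s k)"
    using right_inverse_of_full_rank_factor[OF Uc row_factor_carrier] by blast
  have fact: "?P * ?V = ?P * ?V * R * row_factor k"
  proof (rule tangent_of_low_rank_matrices[OF U_stiefel[OF kd] row_factor_carrier R])
    show "unfolding_mat d n k (Y j) \<in> carrier_mat (n k) ?p" for j by simp
    show "vec_space.rank (n k) (unfolding_mat d n k (Y j)) \<le> s k" for j
      using Y[of j] kd sr by (simp add: tucker_variety_def tucker_rank_def)
    show "?V \<in> carrier_mat (n k) ?p" by simp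
    show "t j > 0" for j by (rule t)
    fix a c assume ac: "a < n k" "c < ?p"
    obtain i where i: "i \<in> multi_indices d n" "i k = a" "unfold_col d n k i = c"
      using unfolding_index_cases[OF kd ac] by blast
    have entry: "unfolding_mat d n k Z $$ (a, c) = Z i" for Z
      using unfolding_mat_entry(2)[OF i(1) kd, of Z] i by simp
    show "(\<lambda>j. unfolding_mat d n k (Y j) $$ (a, c)) \<longlonglongrightarrow> (U k * row_factor k) $$ (a, c)"
      unfolding unfolding_X[OF kd, symmetric] entry using lim unfolding tendsto_fun_iff by blast
    show "(\<lambda>j. 1 / t j * (unfolding_mat d n k (Y j) $$ (a, c) - (U k * row_factor k) $$ (a, c))) \<longlonglongrightarrow>
      ?V $$ (a, c)"
      unfolding unfolding_X[OF kd, symmetric] entry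
      using limV unfolding tendsto_fun_iff by (simp add: tensor_scale_def)
  qed
  define F where "F = ?P * ?V * R"
  have PV: "?P * ?V \<in> carrier_mat (n k) ?p"
    by (rule mult_carrier_mat[OF P(1) unfolding_mat_carrier[of d n k V]])
  have F: "F \<in> carrier_mat (n k) (s k)" unfolding F_def by (rule mult_carrier_mat[OF PV R(1)])
  have Ut: "(U k)\<^sup>T \<in> carrier_mat (s k) (n k)" using Uc by simp
  have "(U k)\<^sup>T * F = (U k)\<^sup>T * ?P * ?V * R"
    unfolding F_def assoc_mult_mat[OF Ut PV R(1), symmetric] assoc_mult_mat[OF Ut P(1)
      unfolding_mat_carrier[of d n k V], symmetric] ..
  also have "\<dots> = 0\<^sub>m (s k) (s k)"
    unfolding P(3) using R(1) left_mult_zero_mat[OF unfolding_mat_carrier[of d n k V]] by simp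
  finally have UF: "(U k)\<^sup>T * F = 0\<^sub>m (s k) (s k)" .
  have nk: "n(k := n k) = n" by simp
  have "mode_map d n n ((\<lambda>l. 1\<^sub>m (n l))(k := ?P)) V = mode_map d n s (U(k := F)) G"
  proof (rule unfolding_mat_inj[OF kd])
    have "unfolding_mat d n k (mode_map d n n ((\<lambda>l. 1\<^sub>m (n l))(k := ?P)) V) = ?P * ?V"
      using unfolding_mode_map_single[OF kd P(1) tangent_vector_tensors[OF V]] unfolding nk .
    also have "\<dots> = F * row_factor k" using fact by (simp only: F_def)
    also have "\<dots> = unfolding_mat d n k (mode_map d n s (U(k := F)) G)"
      using unfolding_replaced_factor[OF kd F] by simp
    finally show "unfolding_mat d n k (mode_map d n n ((\<lambda>l. 1\<^sub>m (n l))(k := ?P)) V) =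
      unfolding_mat d n k (mode_map d n s (U(k := F)) G)" .
  qed simp_all
  then show ?thesis using that F UF by blast
qed

lemma U_Ut_U: "k < d \<Longrightarrow> U k * (U k)\<^sup>T * U k = U k"
  using U_carrier[of k] UtU[of k] by (simp add: assoc_mult_mat[of "U k" "n k" "s k"])

text \<open>\<open>V\<close> is projected to the span of \<open>U l\<close> in the saturated modes \<open>l\<close>, one after another.
  What the projection in mode \<open>m\<close> removes is a tensor \<open>G \<times> U(m := F)\<close>, on which the projections
  already made act as the identity, and to which \<open>W\<close> is orthogonal. What remains at the end is a
  combination of elementary tensors from the first family.\<close>

lemma conditions_imp_inner_zero:
  assumes W: "normal_conditions W" and V: "V \<in> tangent_cone (tucker_variety d n r) X"
  shows "tensor_inner d n W V = 0"
proof -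
  define A where "A = (\<lambda>m l. if l < m \<and> l \<in> saturated then U l * (U l)\<^sup>T else 1\<^sub>m (n l))"
  have A: "A m l \<in> carrier_mat (n l) (n l)" if "l < d" for m l
    using U_carrier[OF that] by (simp add: A_def)
  have AU: "A m l * U l = U l" if "l < d" for m l
    using left_mult_one_mat[OF U_carrier[OF that]] U_Ut_U[OF that]
      by (simp add: A_def del: assoc_mult_mat)
  \<comment> \<open>\<open>A m\<close> projects in the saturated modes below \<open>m\<close>.\<close>
  have "tensor_inner d n W (mode_map d n n (A m) V) = tensor_inner d n W V" if "m \<le> d" for m
    using that
  proof (induction m)
    case 0
    have "A 0 = (\<lambda>l. 1\<^sub>m (n l))" by (simp add: A_def)
    then show ?case by (simp add: mode_map_one[OF tangent_vector_tensors[OF V]])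
  next
    case (Suc m)
    then have m: "m < d"
      and IH: "tensor_inner d n W (mode_map d n n (A m) V) = tensor_inner d n W V" by auto
    show ?case
    proof (cases "m \<in> saturated")
      case False
      then have "A (Suc m) = A m" by (auto simp: A_def fun_eq_iff less_Suc_eq)
      then show ?thesis using IH by simp
    next
      case True
      note Um = U_carrier[OF m]
      let ?Q = "U m * (U m)\<^sup>T" and ?P = "proj_perp (U m)"
      have Q: "?Q \<in> carrier_mat (n m) (n m)" using Um by simp
      have P: "?P \<in> carrier_mat (n m) (n m)" using proj_perp_props[OF U_stiefel[OF m]] by simp
      have QP: "?Q + ?P = 1\<^sub>m (n m)"
        using Um Q by (intro eq_matI) (auto simp: proj_perp_def)
      have Am: "A m m = 1\<^sub>m (n m)" by (simp add: A_def)
      obtain F where F: "F \<in> carrier_mat (n m) (s m)" "(U m)\<^sup>T * F = 0\<^sub>m (s m) (s m)"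
        "mode_map d n n ((\<lambda>l. 1\<^sub>m (n l))(m := ?P)) V = mode_map d n s (U(m := F)) G"
        using tangent_vector_perp_part[OF V True] by blast
      have "(A m)(m := ?Q) = A (Suc m)" using True by (auto simp: A_def fun_eq_iff less_Suc_eq)
      moreover have "(A m)(m := ?Q + ?P) = A m" using Am QP by (simp add: fun_eq_iff)
      ultimately have split: "mode_map d n n (A m) V =
        mode_map d n n (A (Suc m)) V + mode_map d n n ((A m)(m := ?P)) V"
        using mode_map_add_factor[of m d ?Q n n ?P "A m" V, OF m Q P] by simp
      have "mode_map d n n ((A m)(m := ?P)) V =
          mode_map d n n (A m) (mode_map d n n ((\<lambda>l. 1\<^sub>m (n l))(m := ?P)) V)"
      proof (rule mode_map_nested_factor[symmetric])
        fix l assume l: "l < d"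
        show "A m l \<in> carrier_mat (n l) (n l)" by (rule A[OF l])
        show "((\<lambda>l. 1\<^sub>m (n l))(m := ?P)) l \<in> carrier_mat (n l) (n l)" using P by simp
        show "A m l * ((\<lambda>l. 1\<^sub>m (n l))(m := ?P)) l = ((A m)(m := ?P)) l"
          using Am left_mult_one_mat[OF P] right_mult_one_mat[OF A[OF l]] by simp
      qed
      also have "\<dots> = mode_map d n n (A m) (mode_map d n s (U(m := F)) G)" by (simp only: F(3))
      also have "\<dots> = mode_map d n s (U(m := F)) G"
      proof (rule mode_map_nested_factor)
        fix l assume l: "l < d"
        show "A m l \<in> carrier_mat (n l) (n l)" by (rule A[OF l])
        show "(U(m := F)) l \<in> carrier_mat (n l) (s l)" by (rule U_upd_carrier[OF F(1) l])
        show "A m l * (U(m := F)) l = (U(m := F)) l"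
          using Am left_mult_one_mat[OF F(1)] AU[OF l] by simp
      qed
      finally have "tensor_inner d n W (mode_map d n n ((A m)(m := ?P)) V) = 0"
        using W True F unfolding normal_conditions_def by metis
      then show ?thesis using IH unfolding split tensor_inner_add_right by simp
    qed
  qed
  then have "tensor_inner d n W V = tensor_inner d n W (mode_map d n n (A d) V)" by simp
  also have "\<dots> = 0"
  proof (rule inner_mode_map_zero[of d "A d" n n mode_space])
    show "A d k \<in> carrier_mat (n k) (n k)" if "k < d" for k by (rule A[OF that])
    show "col (A d k) b \<in> mode_space k" if k: "k < d" and b: "b < n k" for k b
    proof (cases "s k < r k")
      case True
      then show ?thesis using A[OF k] b by (simp add: mode_space_def)
    next
      case False
      then have "A d k = U k * (U k)\<^sup>T" using k s_le_r[OF k] by (simp add: A_def saturated_def)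
      then have "col (A d k) b = U k *\<^sub>v col (U k)\<^sup>T b"
        using col_mult2[OF U_carrier[OF k], of "(U k)\<^sup>T" "n k" b] U_carrier[OF k] b by simp
      then show ?thesis
        using False U_carrier[OF k] b by (auto simp: mode_space_def mat_span_eq[OF U_carrier[OF k]])
    qed
    show "tensor_inner d n W (elementary_tensor d n v) = 0" if "\<And>k. k < d \<Longrightarrow> v k \<in> mode_space k"
      for v
      using W that by (simp add: normal_conditions_def)
  qed
  finally show ?thesis .
qed

lemma normal_cone_iff_conditions:
  "W \<in> normal_cone d n (tucker_variety d n r) X \<longleftrightarrow> normal_conditions W"
proof
  assume W: "normal_conditions W"
  then have "W \<in> tensors d n" by (simp add: normal_conditions_def)
  then show "W \<in> normal_cone d n (tucker_variety d n r) X"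
    using conditions_imp_inner_zero[OF W] by (simp add: normal_cone_def)
qed (rule normal_cone_imp_conditions)

text \<open>The left factors of the equation are the mode-\<open>k\<close> unfolding of a transform \<open>Z\<close> of
  \<open>W\<close>. Pairing it with the core and moving the transformation to the other side leaves \<open>W\<close> paired
  with \<open>G \<times> U(k := P * F)\<close>, where \<open>P = proj_perp (U k)\<close>; the matrices \<open>P * F\<close> are those with
  columns orthogonal to \<open>U k\<close>.\<close>

lemma core_equation_iff:
  assumes k: "k < d"
  shows "proj_perp (U k) * unfolding_mat d n k W * kron_except d U k * (unfolding_mat d s k G)\<^sup>T
      = 0\<^sub>m (n k) (s k) \<longleftrightarrow>
    (\<forall>F\<in>carrier_mat (n k) (s k). (U k)\<^sup>T * F = 0\<^sub>m (s k) (s k) \<longrightarrow>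
      tensor_inner d n W (mode_map d n s (U(k := F)) G) = 0)"
proof -
  note Uc = U_carrier[OF k] and P = proj_perp_props[OF U_stiefel[OF k]]
  let ?P = "proj_perp (U k)"
  let ?m = "s(k := n k)"
  define B where "B = (\<lambda>l. (U l)\<^sup>T)(k := ?P)"
  have B: "B l \<in> carrier_mat (?m l) (n l)" if "l < d" for l
    using transpose_carrier_mat[THEN iffD2, OF U_carrier[OF that]] P(1)
    by (cases "l = k") (simp_all add: B_def del: transpose_carrier_mat)
  define Z where "Z = mode_map d ?m n B W"
  have "(kron_except d B k)\<^sup>T = kron_except d U k"
    unfolding kron_except_transpose by (rule kron_except_cong) (simp add: B_def)
  then have ZB: "unfolding_mat d ?m k Z = ?P * unfolding_mat d n k W * kron_except d U k"
    using unfolding_mode_map[of d B ?m n k W, OF B k]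
      by (simp only: Z_def) (simp only: B_def fun_upd_same)
  have pairing: "tensor_inner d ?m Z (mode_map d ?m s ((\<lambda>l. 1\<^sub>m (s l))(k := F)) G) =
      tensor_inner d n W (mode_map d n s (U(k := ?P * F)) G)" if F: "F \<in> carrier_mat (n k)
        (s k)" for F
  proof -
    have "tensor_inner d ?m Z (mode_map d ?m s ((\<lambda>l. 1\<^sub>m (s l))(k := F)) G) =
        tensor_inner d n W (mode_map d n ?m (\<lambda>l. (B l)\<^sup>T) (mode_map d ?m s ((\<lambda>l. 1\<^sub>m
          (s l))(k := F)) G))"
      unfolding Z_def by (rule mode_map_adjoint[OF B])
    also have "mode_map d n ?m (\<lambda>l. (B l)\<^sup>T) (mode_map d ?m s ((\<lambda>l. 1\<^sub>m (s l))(k := F)) G) =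
        mode_map d n s (U(k := ?P * F)) G"
    proof (rule mode_map_nested_factor)
      fix l assume l: "l < d"
      show "(B l)\<^sup>T \<in> carrier_mat (n l) (?m l)" using B[OF l]
        by (rule transpose_carrier_mat[THEN iffD2])
      show "((\<lambda>l. 1\<^sub>m (s l))(k := F)) l \<in> carrier_mat (?m l) (s l)" using F by simp
      show "(B l)\<^sup>T * ((\<lambda>l. 1\<^sub>m (s l))(k := F)) l = (U(k := ?P * F)) l"
        using P(4) right_mult_one_mat[OF U_carrier[OF l]] by (simp add: B_def)
    qed
    finally show ?thesis .
  qed
  have "?P * unfolding_mat d n k W * kron_except d U k * (unfolding_mat d s k G)\<^sup>T =
    0\<^sub>m (n k) (s k) \<longleftrightarrow>
      (\<forall>F\<in>carrier_mat (n k) (s k). tensor_inner d n W (mode_map d n s (U(k := ?P * F)) G) = 0)"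
    unfolding ZB[symmetric] unfolding_mult_transpose_zero_iff[OF k G_tensors]
    by (rule ball_cong[OF refl]) (simp only: pairing)
  also have "\<dots> \<longleftrightarrow> (\<forall>F\<in>carrier_mat (n k) (s k). (U k)\<^sup>T * F = 0\<^sub>m (s k) (s k) \<longrightarrow>
      tensor_inner d n W (mode_map d n s (U(k := F)) G) = 0)" (is "?l \<longleftrightarrow> ?r")
  proof
    assume l: ?l
    show ?r
    proof (intro ballI impI)
      fix F :: "real mat" assume F: "F \<in> carrier_mat (n k) (s k)" "(U k)\<^sup>T * F = 0\<^sub>m (s k) (s k)"
      have Ut: "(U k)\<^sup>T \<in> carrier_mat (s k) (n k)" using Uc by simp
      have UUF: "U k * (U k)\<^sup>T * F = 0\<^sub>m (n k) (s k)"
        unfolding assoc_mult_mat[OF Uc Ut F(1)] F(2) by (rule right_mult_zero_mat[OF Uc])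
      have "?P * F = F - U k * (U k)\<^sup>T * F"
        unfolding proj_perp_def carrier_matD(1)[OF Uc]
          minus_mult_distrib_mat[OF one_carrier_mat mult_carrier_mat[OF Uc Ut] F(1)]
            left_mult_one_mat[OF F(1)] ..
      also have "\<dots> = F" unfolding UUF using F(1) by (intro eq_matI) auto
      finally have "?P * F = F" .
      then show "tensor_inner d n W (mode_map d n s (U(k := F)) G) = 0" using l F(1) by metis
    qed
  next
    assume r: ?r
    show ?l
    proof
      fix F :: "real mat" assume F: "F \<in> carrier_mat (n k) (s k)"
      have Ut: "(U k)\<^sup>T \<in> carrier_mat (s k) (n k)" using Uc by simp
      have "(U k)\<^sup>T * (?P * F) = 0\<^sub>m (s k) (s k)"
        unfolding assoc_mult_mat[OF Ut P(1) F, symmetric] P(3) by (rule left_mult_zero_mat[OF F])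
      then show "tensor_inner d n W (mode_map d n s (U(k := ?P * F)) G) = 0"
        using r mult_carrier_mat[OF P(1) F] by blast
    qed
  qed
  finally show ?thesis .
qed

end

section \<open>Parametrization by complementary frames\<close>

locale complemented_tucker_point = tucker_point +
  fixes U' :: "nat \<Rightarrow> real mat"
  assumes U'_stiefel: "k < d \<Longrightarrow> U' k \<in> stiefel (n k - s k) (n k)"
    and span_U': "k < d \<Longrightarrow> mat_span (U' k) = vec_orth (n k) (mat_span (U k))"
begin

abbreviation patterns :: "(nat \<Rightarrow> nat) set" where
  "patterns \<equiv> (\<Pi>\<^sub>E k\<in>{..<d}. {0, 1})"

definition frame :: "(nat \<Rightarrow> nat) \<Rightarrow> nat \<Rightarrow> real mat" where
  "frame e k = (if e k = 0 then U k else U' k)"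

definition frame_dim :: "(nat \<Rightarrow> nat) \<Rightarrow> nat \<Rightarrow> nat" where
  "frame_dim e k = (1 - e k) * s k + e k * (n k - s k)"

definition weight :: "(nat \<Rightarrow> nat) \<Rightarrow> real" where
  "weight e = (\<Sum>k\<in>saturated. (real (e k))\<^sup>2)"

definition admissible :: "((nat \<Rightarrow> nat) \<Rightarrow> tensor) \<Rightarrow> bool" where
  "admissible C \<longleftrightarrow> (\<forall>e\<in>patterns. C e \<in> tensors d (frame_dim e) \<and>
     (\<forall>k<d. e k = 1 \<and> (\<forall>j\<in>{..<d} - {k}. e j = 0) \<longrightarrow>
        unfolding_mat d (frame_dim e) k (C e) * (unfolding_mat d s k G)\<^sup>T = 0\<^sub>m (n k - s k) (s k)))"

lemma pattern_cases: "e \<in> patterns \<Longrightarrow> k < d \<Longrightarrow> e k = 0 \<or> e k = 1"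
  by auto

lemma finite_saturated: "finite saturated"
  by (simp add: saturated_def)

lemma frame_stiefel:
  assumes "e \<in> patterns" "k < d"
  shows "frame e k \<in> stiefel (frame_dim e k) (n k)"
  using pattern_cases[OF assms] U_stiefel[OF assms(2)] U'_stiefel[OF assms(2)]
  by (auto simp: frame_def frame_dim_def)

lemma frame_carrier:
  assumes "e \<in> patterns" "k < d"
  shows "frame e k \<in> carrier_mat (n k) (frame_dim e k)"
  using stiefelD(1)[OF frame_stiefel[OF assms]] .

lemma complement:
  assumes "k < d"
  shows "U k * (U k)\<^sup>T + U' k * (U' k)\<^sup>T = 1\<^sub>m (n k)" "(U' k)\<^sup>T * U k = 0\<^sub>m (n k - s k) (s k)"
  using stiefel_complement[OF U_stiefel[OF assms] U'_stiefel[OF assms] span_U'[OF assms]] by auto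

lemma U'_carrier: "k < d \<Longrightarrow> U' k \<in> carrier_mat (n k) (n k - s k)"
  using U'_stiefel stiefelD by blast

lemma UtU':
  assumes "k < d"
  shows "(U k)\<^sup>T * U' k = 0\<^sub>m (s k) (n k - s k)"
proof -
  have "((U' k)\<^sup>T * U k)\<^sup>T = (U k)\<^sup>T * U' k"
    using transpose_mult[OF transpose_carrier_mat[THEN iffD2, OF U'_carrier[OF assms]]
      U_carrier[OF assms]] by simp
  then show ?thesis by (simp add: complement(2)[OF assms])
qed

lemma sum_frame_projections:
  assumes "W \<in> tensors d n"
  shows "W = (\<Sum>e\<in>patterns. mode_map d n (frame_dim e) (frame e)
    (mode_map d (frame_dim e) n (\<lambda>k. (frame e k)\<^sup>T) W))"
proof -
  have Q: "U k * (U k)\<^sup>T \<in> carrier_mat (n k) (n k)" "U' k * (U' k)\<^sup>T \<in> carrier_mat (n k) (n k)"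
    if "k < d" for k
    using U_carrier[OF that] U'_carrier[OF that] by simp_all
  have "W = mode_map d n n (\<lambda>k. 1\<^sub>m (n k)) W" by (simp add: mode_map_one[OF assms])
  also have "\<dots> = mode_map d n n (\<lambda>k. U k * (U k)\<^sup>T + U' k * (U' k)\<^sup>T) W"
    by (rule mode_map_cong) (simp_all add: complement)
  also have "\<dots> = (\<Sum>e\<in>patterns. mode_map d n n
      (\<lambda>k. if e k = 0 then U k * (U k)\<^sup>T else U' k * (U' k)\<^sup>T) W)"
    by (rule mode_map_sum_expand) (use Q in auto)
  also have "\<dots> = (\<Sum>e\<in>patterns. mode_map d n (frame_dim e) (frame e)
    (mode_map d (frame_dim e) n (\<lambda>k. (frame e k)\<^sup>T) W))"
  proof (rule sum.cong[OF refl])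
    fix e assume e: "e \<in> patterns"
    show "mode_map d n n (\<lambda>k. if e k = 0 then U k * (U k)\<^sup>T else U' k * (U' k)\<^sup>T) W =
        mode_map d n (frame_dim e) (frame e) (mode_map d (frame_dim e) n (\<lambda>k. (frame e k)\<^sup>T) W)"
    proof (rule mode_map_nested_factor[symmetric])
      fix k assume k: "k < d"
      show "frame e k \<in> carrier_mat (n k) (frame_dim e k)" by (rule frame_carrier[OF e k])
      then show "(frame e k)\<^sup>T \<in> carrier_mat (frame_dim e k) (n k)"
        by (rule transpose_carrier_mat[THEN iffD2])
      show "frame e k * (frame e k)\<^sup>T = (if e k = 0 then U k * (U k)\<^sup>T else U' k * (U' k)\<^sup>T)"
        by (simp add: frame_def)
    qed
  qed
  finally show ?thesis .
qed

lemma weight_zero_iff: "weight e = 0 \<longleftrightarrow> (\<forall>k\<in>saturated. e k = 0)"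
  unfolding weight_def by (subst sum_nonneg_eq_0_iff) (auto simp: finite_saturated)

text \<open>If \<open>e\<close> chooses \<open>U\<close> in all saturated modes, then the columns of the frames lie in the
  mode spaces. The coefficient \<open>Z\<close> of \<open>W\<close> satisfies \<open>\<langle>Z, Z\<rangle> = \<langle>W, Z'\<rangle>\<close>, where \<open>Z'\<close> is the
  transform of \<open>Z\<close> by these frames and hence belongs to the span of the first family.\<close>

lemma frame_coefficient_zero:
  assumes W: "normal_conditions W" and e: "e \<in> patterns" and zero: "weight e = 0"
  shows "mode_map d (frame_dim e) n (\<lambda>k. (frame e k)\<^sup>T) W = 0" (is "?Z = 0")
proof (rule tensor_inner_self_zero[of _ d "frame_dim e"])
  have At: "(frame e k)\<^sup>T \<in> carrier_mat (frame_dim e k) (n k)" if "k < d" for k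
    using frame_carrier[OF e that] by simp
  have "tensor_inner d (frame_dim e) ?Z ?Z =
    tensor_inner d n W (mode_map d n (frame_dim e) (frame e) ?Z)"
    using mode_map_adjoint[of d "\<lambda>k. (frame e k)\<^sup>T" "frame_dim e" n W ?Z, OF At] by simp
  also have "\<dots> = 0"
  proof (rule inner_mode_map_zero[of d "frame e" n "frame_dim e" mode_space])
    show "frame e k \<in> carrier_mat (n k) (frame_dim e k)" if "k < d" for k
      by (rule frame_carrier[OF e that])
    show "col (frame e k) b \<in> mode_space k" if k: "k < d" and b: "b < frame_dim e k" for k b
    proof (cases "s k < r k")
      case True
      then show ?thesis using frame_carrier[OF e k] b by (simp add: mode_space_def)
    next
      case False
      then have "k \<in> saturated" using s_le_r[OF k] k by (simp add: saturated_def)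
      then have e0: "e k = 0" using zero by (simp add: weight_zero_iff)
      then have "b < s k" using b by (simp add: frame_dim_def)
      then show ?thesis using False e0 col_in_mat_span[OF U_carrier[OF k]]
        by (simp add: frame_def mode_space_def)
    qed
    show "tensor_inner d n W (elementary_tensor d n v) = 0" if "\<And>k. k < d \<Longrightarrow> v k \<in> mode_space k"
      for v
      using W that by (simp add: normal_conditions_def)
  qed
  finally show "tensor_inner d (frame_dim e) ?Z ?Z = 0" .
qed simp

lemma frame_dim_single:
  assumes "\<forall>j\<in>{..<d} - {k}. e j = 0" "e k = 1" "l < d"
  shows "frame_dim e l = (s(k := n k - s k)) l"
  using assms by (cases "l = k") (auto simp: frame_dim_def)

lemma admissible_equation_iff:
  assumes k: "k < d" and e: "\<forall>j\<in>{..<d} - {k}. e j = 0" "e k = 1"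
  shows "unfolding_mat d (frame_dim e) k Z * (unfolding_mat d s k G)\<^sup>T = 0\<^sub>m (n k - s k) (s k) \<longleftrightarrow>
    (\<forall>F\<in>carrier_mat (n k - s k) (s k).
      tensor_inner d (frame_dim e) Z (mode_map d (frame_dim e) s ((\<lambda>l. 1\<^sub>m (s l))(k := F)) G) = 0)"
proof -
  note dim = frame_dim_single[OF e]
  have "mode_map d (frame_dim e) s A G = mode_map d (s(k := n k - s k)) s A G" for A
    by (rule mode_map_cong[OF dim]) auto
  moreover have "unfolding_mat d (frame_dim e) k Z = unfolding_mat d (s(k := n k - s k)) k Z"
    by (rule unfolding_mat_cong[OF dim k])
  moreover have "tensor_inner d (frame_dim e) = tensor_inner d (s(k := n k - s k))"
    by (rule tensor_inner_cong[OF dim])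
  ultimately show ?thesis
    using unfolding_mult_transpose_zero_iff[OF k G_tensors, of "n k - s k" Z] by simp
qed

text \<open>The coefficients are those of \<open>W\<close> in the frames, divided by the weight. Where the
  weight is zero, the coefficient vanishes as well, so the default \<open>1 / 0 = 0\<close> does no harm.\<close>

lemma conditions_imp_parametrized:
  assumes W: "normal_conditions W"
  obtains C where "admissible C"
    "W = (\<Sum>e\<in>patterns. tensor_scale (weight e) (mode_map d n (frame_dim e) (frame e) (C e)))"
proof
  define Z where "Z = (\<lambda>e. mode_map d (frame_dim e) n (\<lambda>k. (frame e k)\<^sup>T) W)"
  let ?C = "\<lambda>e. tensor_scale (1 / weight e) (Z e)"
  have "W = (\<Sum>e\<in>patterns. mode_map d n (frame_dim e) (frame e) (Z e))"
    unfolding Z_def by (rule sum_frame_projections) (use W in \<open>simp add: normal_conditions_def\<close>)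
  also have "\<dots> =
    (\<Sum>e\<in>patterns. tensor_scale (weight e) (mode_map d n (frame_dim e) (frame e) (?C e)))"
  proof (rule sum.cong[OF refl])
    fix e assume e: "e \<in> patterns"
    show "mode_map d n (frame_dim e) (frame e) (Z e) =
        tensor_scale (weight e) (mode_map d n (frame_dim e) (frame e) (?C e))"
    proof (cases "weight e = 0")
      case True
      then have "Z e = 0" using frame_coefficient_zero[OF W e] by (simp add: Z_def)
      then show ?thesis using True by (auto simp: mode_map_def tensor_scale_def fun_eq_iff)
    next
      case False
      then show ?thesis by (auto simp: mode_map_scale)
    qed
  qed
  finally show "W =
    (\<Sum>e\<in>patterns. tensor_scale (weight e) (mode_map d n (frame_dim e) (frame e) (?C e)))" .
  show "admissible ?C"
    unfolding admissible_def
  proof (intro ballI conjI allI impI)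
    fix e assume e: "e \<in> patterns"
    show "?C e \<in> tensors d (frame_dim e)" by (simp add: Z_def)
    fix k assume k: "k < d" and single: "e k = 1 \<and> (\<forall>j\<in>{..<d} - {k}. e j = 0)"
    have "tensor_inner d (frame_dim e) (?C e) (mode_map d (frame_dim e) s ((\<lambda>l.
      1\<^sub>m (s l))(k := F)) G) = 0"
      if F: "F \<in> carrier_mat (n k - s k) (s k)" for F
    proof (cases "k \<in> saturated")
      case False
      then have "weight e = 0" using single by (auto simp: weight_zero_iff saturated_def)
      then show ?thesis by (simp add: tensor_inner_def tensor_scale_def)
    next
      case True
      let ?M = "mode_map d (frame_dim e) s ((\<lambda>l. 1\<^sub>m (s l))(k := F)) G"
      have At: "(frame e l)\<^sup>T \<in> carrier_mat (frame_dim e l) (n l)" if "l < d" for l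
        using frame_carrier[OF e that] by simp
      have UF: "U' k * F \<in> carrier_mat (n k) (s k)"
        by (rule mult_carrier_mat[OF U'_carrier[OF k] F])
      have "tensor_inner d (frame_dim e) (Z e) ?M =
        tensor_inner d n W (mode_map d n (frame_dim e) (frame e) ?M)"
        using mode_map_adjoint[of d "\<lambda>k. (frame e k)\<^sup>T" "frame_dim e" n W ?M, OF At]
          by (simp add: Z_def)
      also have "mode_map d n (frame_dim e) (frame e) ?M = mode_map d n s (U(k := U' k * F)) G"
      proof (rule mode_map_nested_factor)
        fix l assume l: "l < d"
        show "frame e l \<in> carrier_mat (n l) (frame_dim e l)" by (rule frame_carrier[OF e l])
        show "((\<lambda>l. 1\<^sub>m (s l))(k := F)) l \<in> carrier_mat (frame_dim e l) (s l)"
          using frame_dim_single[of k e l] single l F by simp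
        show "frame e l * ((\<lambda>l. 1\<^sub>m (s l))(k := F)) l = (U(k := U' k * F)) l"
          using single l right_mult_one_mat[OF U_carrier[OF l]] by (simp add: frame_def)
      qed
      also have "tensor_inner d n W (mode_map d n s (U(k := U' k * F)) G) = 0"
      proof -
        have "(U k)\<^sup>T * (U' k * F) = (U k)\<^sup>T * U' k * F"
          by (rule assoc_mult_mat[OF transpose_carrier_mat[THEN iffD2, OF U_carrier[OF k]]
            U'_carrier[OF k] F, symmetric])
        also have "\<dots> = 0\<^sub>m (s k) (s k)" unfolding UtU'[OF k] by (rule left_mult_zero_mat[OF F])
        finally show ?thesis using W True UF unfolding normal_conditions_def by blast
      qed
      finally show ?thesis by (simp only: tensor_inner_scale_left mult_zero_right)
    qed
    then show "unfolding_mat d (frame_dim e) k (?C e) * (unfolding_mat d s k G)\<^sup>T =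
      0\<^sub>m (n k - s k) (s k)"
      using admissible_equation_iff[OF k] single by blast
  qed
qed

text \<open>A term of nonzero weight has a factor \<open>U' k\<close> in a saturated mode, which is orthogonal
  to every factor in the span of \<open>U k\<close>. Against \<open>G \<times> U(k := F)\<close>, a term vanishes if it chooses
  \<open>U'\<close> in a mode other than \<open>k\<close>, since \<open>U'\<^sup>T U = 0\<close>, or \<open>U\<close> in mode \<open>k\<close>, since \<open>U\<^sup>T F = 0\<close>. The
  only other choice is the one constrained by the core.\<close>

lemma parametrized_imp_conditions:
  assumes C: "admissible C"
  shows "normal_conditions (\<Sum>e\<in>patterns.
    tensor_scale (weight e) (mode_map d n (frame_dim e) (frame e) (C e)))"
    (is "normal_conditions ?W")
  unfolding normal_conditions_def
proof (intro conjI allI impI ballI)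
  show "?W \<in> tensors d n" by (intro sum_tensors tensor_scale_tensors mode_map_tensors)
next
  fix v assume v: "\<forall>k<d. v k \<in> mode_space k"
  have vc: "v k \<in> carrier_vec (n k)" if "k < d" for k
  proof -
    have "v k \<in> mode_space k" using v that by blast
    then show ?thesis
      using U_carrier[OF that] mat_span_eq[OF U_carrier[OF that]]
        by (auto simp: mode_space_def split: if_splits)
  qed
  have "weight e *
    tensor_inner d n (mode_map d n (frame_dim e) (frame e) (C e)) (elementary_tensor d n v) = 0"
    if e: "e \<in> patterns" for e
  proof (cases "weight e = 0")
    case False
    then obtain k where k: "k \<in> saturated" "e k \<noteq> 0" by (auto simp: weight_zero_iff)
    then have kd: "k < d" and "v k \<in> mat_span (U k)" using v
      by (auto simp: saturated_def mode_space_def)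
    then have orth: "col (U' k) b \<bullet> v k = 0" if "b < n k - s k" for b
      using col_in_mat_span[OF U'_carrier[OF kd] that] span_U'[OF kd] by (auto simp: vec_orth_def)
    have "(\<Prod>l<d. col (frame e l) (j l) \<bullet> v l) = 0" if j: "j \<in> multi_indices d (frame_dim e)" for j
    proof (rule prod_zero)
      have "j k < n k - s k"
        using multi_indices_less[OF j kd] k(2) pattern_cases[OF e kd] by (auto simp: frame_dim_def)
      then show "\<exists>l\<in>{..<d}. col (frame e l) (j l) \<bullet> v l = 0"
        using orth kd k(2) by (intro bexI[of _ k]) (auto simp: frame_def)
    qed simp
    then show ?thesis
      using inner_mode_map_elementary[of d "frame e" n "frame_dim e" v "C e", OF frame_carrier[OF
        e] vc] by simp
  qed simp
  then show "tensor_inner d n ?W (elementary_tensor d n v) = 0"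
    by (simp add: tensor_inner_sum_left tensor_inner_scale_left)
next
  fix k and F :: "real mat"
  assume k: "k \<in> saturated" and F: "F \<in> carrier_mat (n k) (s k)" "(U k)\<^sup>T * F = 0\<^sub>m (s k) (s k)"
  have kd: "k < d" using k by (simp add: saturated_def)
  let ?M = "mode_map d n s (U(k := F)) G"
  have "tensor_inner d n (mode_map d n (frame_dim e) (frame e) (C e)) ?M = 0" if e: "e \<in> patterns"
    for e
  proof -
    have At: "(frame e l)\<^sup>T \<in> carrier_mat (frame_dim e l) (n l)" if "l < d" for l
      using frame_carrier[OF e that] by simp
    have adj: "tensor_inner d n (mode_map d n (frame_dim e) (frame e) (C e)) ?M =
        tensor_inner d (frame_dim e) (C e) (mode_map d (frame_dim e) n (\<lambda>l. (frame e l)\<^sup>T) ?M)"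
      by (rule mode_map_adjoint[OF frame_carrier[OF e]])
    have comp: "mode_map d (frame_dim e) n (\<lambda>l. (frame e l)\<^sup>T) ?M =
        mode_map d (frame_dim e) s (\<lambda>l. (frame e l)\<^sup>T * (U(k := F)) l) G"
      by (rule mode_map_compose[OF At U_upd_carrier[OF F(1)]])
    show ?thesis
    proof (cases "\<exists>l<d. (frame e l)\<^sup>T * (U(k := F)) l = 0\<^sub>m (frame_dim e l) (s l)")
      case True
      then show ?thesis unfolding adj comp using mode_map_zero_factor[of _ d _ "frame_dim e" s]
        by auto
    next
      case False
      have ek: "e k = 1"
      proof (rule ccontr)
        assume "e k \<noteq> 1"
        then have "e k = 0" using pattern_cases[OF e kd] by simp
        then show False using False kd F(2) by (auto simp: frame_def frame_dim_def)
      qed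
      have el: "e l = 0" if "l < d" "l \<noteq> k" for l
      proof (rule ccontr)
        assume "e l \<noteq> 0"
        then have "e l = 1" using pattern_cases[OF e that(1)] by simp
        then show False using False that complement(2)[OF that(1)]
          by (auto simp: frame_def frame_dim_def)
      qed
      have "mode_map d (frame_dim e) s (\<lambda>l. (frame e l)\<^sup>T * (U(k := F)) l) G =
          mode_map d (frame_dim e) s ((\<lambda>l. 1\<^sub>m (s l))(k := (U' k)\<^sup>T * F)) G"
        by (rule mode_map_cong) (use ek el UtU in \<open>auto simp: frame_def\<close>)
      moreover have "(U' k)\<^sup>T * F \<in> carrier_mat (n k - s k) (s k)"
        by (rule mult_carrier_mat[OF transpose_carrier_mat[THEN iffD2, OF U'_carrier[OF kd]] F(1)])
      moreover have "unfolding_mat d (frame_dim e) k (C e) * (unfolding_mat d s k G)\<^sup>T =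
        0\<^sub>m (n k - s k) (s k)"
        using C e kd ek el by (auto simp: admissible_def)
      ultimately show ?thesis
        unfolding adj comp using admissible_equation_iff[OF kd, of e "C e"] ek el by auto
    qed
  qed
  then show "tensor_inner d n ?W ?M = 0"
    by (simp add: tensor_inner_sum_left tensor_inner_scale_left)
qed

end

section \<open>The explicit form of the normal cone\<close>

theorem proposition3p1:
  fixes d :: nat and n r s :: "nat \<Rightarrow> nat" and X G :: tensor and U :: "nat \<Rightarrow> real mat"
    and I :: "nat set" and S :: "nat \<Rightarrow> real vec set"
    and sdim :: "(nat \<Rightarrow> nat) \<Rightarrow> nat \<Rightarrow> nat"
  assumes "d > 0" and "\<forall>k<d. n k > 0" and "\<forall>k<d. r k > 0"
    and "X \<in> tucker_variety d n r"
    and "tucker_decomposition d n X s G U"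
    and "I = {k. k < d \<and> s k < r k}"
    and "S = (\<lambda>k. if k \<in> I then carrier_vec (n k) else mat_span (U k))"
    and "sdim = (\<lambda>e k. (1 - e k) * s k + e k * (n k - s k))"
  shows
    "normal_cone d n (tucker_variety d n r) X =
       tensor_orth d n (tensor_prod_subspace d n S) \<inter>
       {W \<in> tensors d n. \<forall>k\<in>{..<d} - I.
          proj_perp (U k) * unfolding_mat d n k W * kron_except d U k * (unfolding_mat d s k G)\<^sup>T
            = 0\<^sub>m (n k) (s k)}
     \<and>
     (\<forall>U' :: nat \<Rightarrow> real mat.
        (\<forall>k<d. U' k \<in> stiefel (n k - s k) (n k) \<and>
               mat_span (U' k) = vec_orth (n k) (mat_span (U k))) \<longrightarrow>
        normal_cone d n (tucker_variety d n r) X =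
          {\<Sum>e\<in>(\<Pi>\<^sub>E k\<in>{..<d}. {0, 1}).
              tensor_scale (\<Sum>k\<in>{..<d} - I. (real (e k))\<^sup>2)
                (mode_prods d (sdim e) (C e) (\<lambda>k. if e k = 0 then U k else U' k)) | C.
           \<forall>e\<in>(\<Pi>\<^sub>E k\<in>{..<d}. {0, 1}).
             C e \<in> tensors d (sdim e) \<and>
             (\<forall>k<d. e k = 1 \<and> (\<forall>j\<in>{..<d} - {k}. e j = 0) \<longrightarrow>
                unfolding_mat d (sdim e) k (C e) * (unfolding_mat d s k G)\<^sup>T
                  = 0\<^sub>m (n k - s k) (s k))})"
proof (intro conjI allI impI)
  interpret tucker_point d n r s X G U by (rule tucker_point.intro) (fact assms)+
  have saturated: "{..<d} - I = saturated"
    using s_le_r unfolding assms(6) saturated_def by (auto simp: le_less)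
  have S: "S k = mode_space k" if "k < d" for k
    using that unfolding assms(6,7) by (simp add: mode_space_def)
  show "normal_cone d n (tucker_variety d n r) X =
       tensor_orth d n (tensor_prod_subspace d n S) \<inter>
       {W \<in> tensors d n. \<forall>k\<in>{..<d} - I.
          proj_perp (U k) * unfolding_mat d n k W * kron_except d U k * (unfolding_mat d s k G)\<^sup>T
            = 0\<^sub>m (n k) (s k)}" (is "_ = ?O \<inter> ?K")
  proof (rule Set.set_eqI)
    fix W
    have "W \<in> ?K \<longleftrightarrow> W \<in> tensors d n \<and> (\<forall>k\<in>saturated. \<forall>F\<in>carrier_mat (n k) (s k).
        (U k)\<^sup>T * F = 0\<^sub>m (s k) (s k) \<longrightarrow> tensor_inner d n W (mode_map d n s (U(k := F)) G) = 0)"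
    proof -
      have "k < d" if "k \<in> saturated" for k using that by (simp add: saturated_def)
      then show ?thesis unfolding saturated by (auto simp: core_equation_iff)
    qed
    moreover have "W \<in> ?O \<longleftrightarrow> W \<in> tensors d n \<and> (\<forall>v. (\<forall>k<d. v k \<in> mode_space k) \<longrightarrow>
        tensor_inner d n W (elementary_tensor d n v) = 0)"
      unfolding tensor_orth_prod_subspace using S by simp
    ultimately show "W \<in> normal_cone d n (tucker_variety d n r) X \<longleftrightarrow> W \<in> ?O \<inter> ?K"
      unfolding normal_cone_iff_conditions normal_conditions_def by blast
  qed
  fix U' :: "nat \<Rightarrow> real mat"
  assume U': "\<forall>k<d. U' k \<in> stiefel (n k - s k) (n k) \<and> mat_span (U' k) =
    vec_orth (n k) (mat_span (U k))"
  interpret complemented_tucker_point d n r s X G U U' by unfold_locales (use U' in auto)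
  have dim: "sdim e = frame_dim e" for e unfolding assms(8) by (simp add: frame_dim_def fun_eq_iff)
  have prods: "mode_prods d (sdim e) (C e) (\<lambda>k. if e k = 0 then U k else U' k) =
      mode_map d n (frame_dim e) (frame e) (C e)" if "admissible C" "e \<in> patterns" for C e
  proof -
    have "(\<lambda>k. if e k = 0 then U k else U' k) = frame e" by (simp add: frame_def fun_eq_iff)
    moreover have "C e \<in> tensors d (frame_dim e)" using that by (simp add: admissible_def)
    ultimately show ?thesis
      using mode_prods_eq_mode_map[of d "frame e" n "frame_dim e" "C e", OF frame_carrier[OF
        that(2)]] by (simp add: dim)
  qed
  have sums: "(\<Sum>e\<in>patterns. tensor_scale (\<Sum>k\<in>{..<d} - I. (real (e k))\<^sup>2)
        (mode_prods d (sdim e) (C e) (\<lambda>k. if e k = 0 then U k else U' k))) =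
      (\<Sum>e\<in>patterns. tensor_scale (weight e) (mode_map d n (frame_dim e) (frame e) (C e)))"
    if "admissible C" for C
    by (rule sum.cong[OF refl]) (simp only: prods[OF that] saturated weight_def)
  show "normal_cone d n (tucker_variety d n r) X =
          {\<Sum>e\<in>patterns. tensor_scale (\<Sum>k\<in>{..<d} - I. (real (e k))\<^sup>2)
                (mode_prods d (sdim e) (C e) (\<lambda>k. if e k = 0 then U k else U' k)) | C.
           \<forall>e\<in>patterns. C e \<in> tensors d (sdim e) \<and>
             (\<forall>k<d. e k = 1 \<and> (\<forall>j\<in>{..<d} - {k}. e j = 0) \<longrightarrow>
                unfolding_mat d (sdim e) k (C e) * (unfolding_mat d s k G)\<^sup>T
                  = 0\<^sub>m (n k - s k) (s k))}"
    unfolding dim admissible_def[symmetric]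
  proof (intro subset_antisym subsetI)
    fix W assume "W \<in> normal_cone d n (tucker_variety d n r) X"
    then obtain C where C: "admissible C"
      "W = (\<Sum>e\<in>patterns. tensor_scale (weight e) (mode_map d n (frame_dim e) (frame e) (C e)))"
      using conditions_imp_parametrized unfolding normal_cone_iff_conditions by blast
    then show "W \<in> {\<Sum>e\<in>patterns. tensor_scale (\<Sum>k\<in>{..<d} - I. (real (e k))\<^sup>2)
                (mode_prods d (frame_dim e) (C e) (\<lambda>k.
                  if e k = 0 then U k else U' k)) | C. admissible C}"
      using sums[OF C(1)] unfolding dim by (intro CollectI exI[of _ C]) simp
  next
    fix W assume "W \<in> {\<Sum>e\<in>patterns. tensor_scale (\<Sum>k\<in>{..<d} - I. (real (e k))\<^sup>2)
                (mode_prods d (frame_dim e) (C e) (\<lambda>k.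
                  if e k = 0 then U k else U' k)) | C. admissible C}"
    then obtain C where C: "admissible C"
      and "W = (\<Sum>e\<in>patterns. tensor_scale (\<Sum>k\<in>{..<d} - I. (real (e k))\<^sup>2)
                (mode_prods d (frame_dim e) (C e) (\<lambda>k. if e k = 0 then U k else U' k)))" by auto
    then have "W =
      (\<Sum>e\<in>patterns. tensor_scale (weight e) (mode_map d n (frame_dim e) (frame e) (C e)))"
      using sums[OF C] unfolding dim by simp
    then show "W \<in> normal_cone d n (tucker_variety d n r) X"
      unfolding normal_cone_iff_conditions using parametrized_imp_conditions[OF C] by simp
  qed
qed

end
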